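(* Let $I$ be an instance of the Course Allocation problem with compulsory prerequisites (CAPR) in which applicants have lexicographic preferences, and let $\sigma$ be a policy for $I$. Then algorithm SM-CAPR run on $I$ and $\sigma$ outputs a Pareto optimal matching of $I$, and it runs in time $O(N+n_2(L+\Delta))$, where $N$ is the sum of the applicants' capacities, $n_2$ is the number of courses, $L$ is the total length of the applicants' preference lists and $\Delta$ is the total number of immediate prerequisites of the courses, taken over all applicants.
   Context: An instance of CAPR consists of a set of applicants $A=\{a_1,\dots,a_{n_1}\}$, a set of courses $C=\{c_1,\dots,c_{n_2}\}$, a positive integer capacity $q(x)$ for every applicant and course $x$, for each applicant $a_i$ a strict linear order $P(a_i)$ (her preference list) over a subset of $C$ (the courses acceptable to $a_i$), and for each applicant $a_i$ a strict partial order $\to_{a_i}$ on $C$ (her prerequisites), given as input by its immediate prerequisites: $c_k$ is an immediate prerequisite of $c_j$ for $a_i$ if $c_j\to_{a_i}c_k$ and there is no $c_l$ with $c_j\to_{a_i}c_l\to_{a_i}c_k$. For $c_j\in C$, $D_{a_i}(c_j)$ denotes the set consisting of $c_j$ and all $c_k$ with $c_j\to_{a_i}c_k$; it is assumed that $D_{a_i}(c_j)$ consists of acceptable courses of $a_i$ whenever $c_j$ is acceptable to $a_i$. A bundle $C'\subseteq C$ is feasible for $a_i$ if its courses are acceptable to $a_i$, $|C'|\le q(a_i)$, and whenever $c_j\in C'$ and $c_j\to_{a_i}c_k$ then $c_k\in C'$. A matching is a set $M\subseteq A\times C$ such that each $M(a_i)=\{c:(a_i,c)\in M\}$ is feasible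 for $a_i$ and each course $c_j$ is assigned to at most $q(c_j)$ applicants; $c_j$ is full if it is assigned to exactly $q(c_j)$ applicants and undersubscribed otherwise. Lexicographic preferences: $a_i$ prefers bundle $C_1$ to bundle $C_2\neq C_1$ iff the course of the symmetric difference $C_1\oplus C_2$ ranked highest in $P(a_i)$ belongs to $C_1$. $M'$ dominates $M$ if some applicant prefers $M'(a_i)$ to $M(a_i)$ and no applicant prefers $M(a_i)$ to $M'(a_i)$; $M$ is Pareto optimal if no matching dominates it. A policy is a sequence of applicants in which each applicant $a_i$ appears at most $q(a_i)$ times. Algorithm SM-CAPR: start with $M=\emptyset$; each applicant has a pointer to the first course in her preference list. Process the entries of $\sigma$ in order; on the turn of $a_i$, repeat the following until either $a_i$ receives a bundle in this turn or her pointer has passed the end of her list (she has exhausted her list): let $c_j$ be the course at her pointer and advance the pointer by one position; if $c_j\notin M(a_i)$ and $c_j$ is undersubscribed, let $S=D_{a_i}(c_j)\setminus M(a_i)$; if no course of $S$ is full and $|M(a_i)|+|S|\le q(a_i)$, add $(a_i,c_k)$ to $M$ for every $c_k\in S$ (and the turn ends). After all entries of $\sigma$ are processed, output $M$.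
   Formalization: Pareto optimality is claimed only if each applicant appears exactly q(a_i) times in the policy or would receive nothing on one further turn; for policies that stop too early (e.g. the empty one) it fails. The matching and time claims hold for all policies. *)

theory Defs
  imports Main
begin

section \<open>Course allocation with compulsory prerequisites\<close>

text \<open>
  Applicants and courses are the indices below \<open>napp\<close> and \<open>ncrs\<close>. The list \<open>pref a\<close> contains the
  acceptable courses of \<open>a\<close>, most preferred first; \<open>(c, d) \<in> prereq a\<close> says that \<open>d\<close> is a
  prerequisite of \<open>c\<close> for \<open>a\<close>.
\<close>

record capr =
  napp :: nat
  ncrs :: nat
  capA :: "nat \<Rightarrow> nat"
  capC :: "nat \<Rightarrow> nat"
  pref :: "nat \<Rightarrow> nat list"
  prereq :: "nat \<Rightarrow> (nat \<times> nat) set"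

definition prereq_closure :: "capr \<Rightarrow> nat \<Rightarrow> nat \<Rightarrow> nat set" where
  "prereq_closure I a c = insert c {d. (c, d) \<in> prereq I a}"

definition immediate :: "capr \<Rightarrow> nat \<Rightarrow> nat \<Rightarrow> nat set" where
  "immediate I a c =
     {d. (c, d) \<in> prereq I a \<and> \<not> (\<exists>e. (c, e) \<in> prereq I a \<and> (e, d) \<in> prereq I a)}"

definition capr_instance :: "capr \<Rightarrow> bool" where
  "capr_instance I \<longleftrightarrow>
     (\<forall>a<napp I. 0 < capA I a) \<and>
     (\<forall>c<ncrs I. 0 < capC I c) \<and>
     (\<forall>a<napp I.
        distinct (pref I a) \<and> set (pref I a) \<subseteq> {..<ncrs I} \<and>
        prereq I a \<subseteq> {..<ncrs I} \<times> {..<ncrs I} \<and> irrefl (prereq I a) \<and> trans (prereq I a) \<and>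
        (\<forall>c\<in>set (pref I a). prereq_closure I a c \<subseteq> set (pref I a)))"

definition feasible :: "capr \<Rightarrow> nat \<Rightarrow> nat set \<Rightarrow> bool" where
  "feasible I a X \<longleftrightarrow>
     X \<subseteq> set (pref I a) \<and> card X \<le> capA I a \<and> (\<forall>c\<in>X. \<forall>d. (c, d) \<in> prereq I a \<longrightarrow> d \<in> X)"

abbreviation (input) bundle_of :: "(nat \<times> nat) set \<Rightarrow> nat \<Rightarrow> nat set" where
  "bundle_of M a \<equiv> M `` {a}"

abbreviation (input) assigned_to :: "(nat \<times> nat) set \<Rightarrow> nat \<Rightarrow> nat set" where
  "assigned_to M c \<equiv> M\<inverse> `` {c}"

definition full :: "capr \<Rightarrow> (nat \<times> nat) set \<Rightarrow> nat \<Rightarrow> bool" where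
  "full I M c \<longleftrightarrow> card (assigned_to M c) = capC I c"

definition matching :: "capr \<Rightarrow> (nat \<times> nat) set \<Rightarrow> bool" where
  "matching I M \<longleftrightarrow>
     M \<subseteq> {..<napp I} \<times> {..<ncrs I} \<and>
     (\<forall>a<napp I. feasible I a (bundle_of M a)) \<and>
     (\<forall>c<ncrs I. card (assigned_to M c) \<le> capC I c)"

definition ranks_above :: "capr \<Rightarrow> nat \<Rightarrow> nat \<Rightarrow> nat \<Rightarrow> bool" where
  "ranks_above I a c d \<longleftrightarrow> (\<exists>i j. i < j \<and> j < length (pref I a) \<and> pref I a ! i = c \<and> pref I a ! j = d)"

definition lex_prefers :: "capr \<Rightarrow> nat \<Rightarrow> nat set \<Rightarrow> nat set \<Rightarrow> bool" where
  "lex_prefers I a X Y \<longleftrightarrow>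
     (\<exists>c \<in> (X - Y) \<union> (Y - X).
        (\<forall>d \<in> (X - Y) \<union> (Y - X). d \<noteq> c \<longrightarrow> ranks_above I a c d) \<and> c \<in> X)"

definition dominates :: "capr \<Rightarrow> (nat \<times> nat) set \<Rightarrow> (nat \<times> nat) set \<Rightarrow> bool" where
  "dominates I M' M \<longleftrightarrow>
     (\<exists>a<napp I. lex_prefers I a (bundle_of M' a) (bundle_of M a)) \<and>
     \<not> (\<exists>a<napp I. lex_prefers I a (bundle_of M a) (bundle_of M' a))"

definition pareto_optimal :: "capr \<Rightarrow> (nat \<times> nat) set \<Rightarrow> bool" where
  "pareto_optimal I M \<longleftrightarrow> matching I M \<and> \<not> (\<exists>M'. matching I M' \<and> dominates I M' M)"

definition policy :: "capr \<Rightarrow> nat list \<Rightarrow> bool" where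
  "policy I \<sigma> \<longleftrightarrow> set \<sigma> \<subseteq> {..<napp I} \<and> (\<forall>a<napp I. count_list \<sigma> a \<le> capA I a)"


section \<open>The algorithm\<close>

text \<open>
  The pointer of an applicant is represented by the part of her list that starts at the pointer.
\<close>

fun turn :: "capr \<Rightarrow> nat \<Rightarrow> nat list \<Rightarrow> (nat \<times> nat) set \<Rightarrow> nat list \<times> (nat \<times> nat) set" where
  "turn I a [] M = ([], M)"
| "turn I a (c # cs) M =
     (let S = prereq_closure I a c - bundle_of M a in
      if c \<notin> bundle_of M a \<and> \<not> full I M c \<and>
         (\<forall>d\<in>S. \<not> full I M d) \<and> card (bundle_of M a) + card S \<le> capA I a
      then (cs, M \<union> {a} \<times> S)
      else turn I a cs M)"

fun run :: "capr \<Rightarrow> nat list \<Rightarrow> (nat \<Rightarrow> nat list) \<Rightarrow> (nat \<times> nat) set \<Rightarrow> (nat \<times> nat) set" where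
  "run I [] r M = M"
| "run I (a # \<sigma>) r M = (let (cs, M') = turn I a (r a) M in run I \<sigma> (r(a := cs)) M')"

definition sm_capr :: "capr \<Rightarrow> nat list \<Rightarrow> (nat \<times> nat) set" where
  "sm_capr I \<sigma> = run I \<sigma> (pref I) {}"

text \<open>
  A policy bounds the number of turns of an applicant only from above. If it stops too early (for
  instance, if it is empty), the output is a matching but need not be Pareto optimal: an applicant
  with turns left could get further courses. Pareto optimality is therefore claimed for those
  policies after which no applicant with turns left would receive a bundle on another turn; these
  include all policies in which every applicant \<open>a\<close> appears exactly \<open>capA I a\<close> times.
\<close>


section \<open>Cost model\<close>

text \<open>
  Running time is measured in a while language over natural-number variables and multi-dimensional
  arrays (a unit-cost random access machine). Each node of an expression that is evaluated
  and each command or loop test that is executed costs one step. The number of indices of an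
  array access is fixed by the program text.
\<close>

datatype ('v, 'r) exp =
    Lit nat
  | Var 'v
  | Rd 'r "('v, 'r) exp list"
  | Plus "('v, 'r) exp" "('v, 'r) exp"

datatype ('v, 'r) bexp =
    Less "('v, 'r) exp" "('v, 'r) exp"
  | Eq "('v, 'r) exp" "('v, 'r) exp"
  | And "('v, 'r) bexp" "('v, 'r) bexp"

datatype ('v, 'r) com =
    SKIP
  | Assign 'v "('v, 'r) exp"  ("(_ ::= _)" [1000, 61] 61)
  | Store 'r "('v, 'r) exp list" "('v, 'r) exp"  ("(_ \<langle>_\<rangle> ::= _)" [1000, 0, 61] 61)
  | Seq "('v, 'r) com" "('v, 'r) com"  ("_;;/ _" [60, 61] 60)
  | If "('v, 'r) bexp" "('v, 'r) com" "('v, 'r) com"  ("(IF _/ THEN _/ ELSE _)" [0, 0, 61] 61)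
  | While "('v, 'r) bexp" "('v, 'r) com"  ("(WHILE _/ DO _)" [0, 61] 61)

record ('v, 'r) store =
  vars :: "'v \<Rightarrow> nat"
  arrs :: "'r \<Rightarrow> nat list \<Rightarrow> nat"

primrec val :: "('v, 'r) store \<Rightarrow> ('v, 'r) exp \<Rightarrow> nat" where
  "val s (Lit n) = n"
| "val s (Var x) = vars s x"
| "val s (Rd r es) = arrs s r (map (val s) es)"
| "val s (Plus e f) = val s e + val s f"

primrec bval :: "('v, 'r) store \<Rightarrow> ('v, 'r) bexp \<Rightarrow> bool" where
  "bval s (Less e f) = (val s e < val s f)"
| "bval s (Eq e f) = (val s e = val s f)"
| "bval s (And b c) = (bval s b \<and> bval s c)"

primrec cost :: "('v, 'r) exp \<Rightarrow> nat" where
  "cost (Lit n) = 1"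
| "cost (Var x) = 1"
| "cost (Rd r es) = 1 + sum_list (map cost es)"
| "cost (Plus e f) = 1 + cost e + cost f"

primrec bcost :: "('v, 'r) bexp \<Rightarrow> nat" where
  "bcost (Less e f) = 1 + cost e + cost f"
| "bcost (Eq e f) = 1 + cost e + cost f"
| "bcost (And b c) = 1 + bcost b + bcost c"

definition upd_var :: "'v \<Rightarrow> nat \<Rightarrow> ('v, 'r) store \<Rightarrow> ('v, 'r) store" where
  "upd_var x n s = s\<lparr>vars := (vars s)(x := n)\<rparr>"

definition upd_arr :: "'r \<Rightarrow> nat list \<Rightarrow> nat \<Rightarrow> ('v, 'r) store \<Rightarrow> ('v, 'r) store" where
  "upd_arr r is n s = s\<lparr>arrs := (arrs s)(r := (arrs s r)(is := n))\<rparr>"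

text \<open>\<open>(p, s) \<Rightarrow>[t] s'\<close>: program \<open>p\<close> started in \<open>s\<close> terminates in \<open>s'\<close> after \<open>t\<close> steps.\<close>

inductive exec :: "('v, 'r) com \<times> ('v, 'r) store \<Rightarrow> nat \<Rightarrow> ('v, 'r) store \<Rightarrow> bool"
  ("_ \<Rightarrow>[_] _" [55, 0, 55] 55)
where
  Skip: "(SKIP, s) \<Rightarrow>[1] s"
| Assign: "(x ::= e, s) \<Rightarrow>[1 + cost e] upd_var x (val s e) s"
| Store: "(r \<langle>es\<rangle> ::= e, s) \<Rightarrow>[1 + sum_list (map cost es) + cost e]
            upd_arr r (map (val s) es) (val s e) s"
| Seq: "(p, s) \<Rightarrow>[t] s' \<Longrightarrow> (q, s') \<Rightarrow>[u] s'' \<Longrightarrow> (p;; q, s) \<Rightarrow>[1 + t + u] s''"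
| IfTrue: "bval s b \<Longrightarrow> (p, s) \<Rightarrow>[t] s' \<Longrightarrow> (IF b THEN p ELSE q, s) \<Rightarrow>[1 + bcost b + t] s'"
| IfFalse: "\<not> bval s b \<Longrightarrow> (q, s) \<Rightarrow>[t] s' \<Longrightarrow> (IF b THEN p ELSE q, s) \<Rightarrow>[1 + bcost b + t] s'"
| WhileFalse: "\<not> bval s b \<Longrightarrow> (WHILE b DO p, s) \<Rightarrow>[1 + bcost b] s"
| WhileTrue: "bval s b \<Longrightarrow> (p, s) \<Rightarrow>[t] s' \<Longrightarrow> (WHILE b DO p, s') \<Rightarrow>[u] s'' \<Longrightarrow>
    (WHILE b DO p, s) \<Rightarrow>[1 + bcost b + t + u] s''"

inductive_cases exec_SkipE: "(SKIP, s) \<Rightarrow>[t] s'"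
inductive_cases exec_AssignE: "(x ::= e, s) \<Rightarrow>[t] s'"
inductive_cases exec_StoreE: "(r \<langle>es\<rangle> ::= e, s) \<Rightarrow>[t] s'"
inductive_cases exec_SeqE: "(p;; q, s) \<Rightarrow>[t] s'"
inductive_cases exec_IfE: "(IF b THEN p ELSE q, s) \<Rightarrow>[t] s'"
inductive_cases exec_WhileE: "(WHILE b DO p, s) \<Rightarrow>[t] s'"

lemma exec_deterministic:
  "ps \<Rightarrow>[t] s' \<Longrightarrow> ps \<Rightarrow>[u] s'' \<Longrightarrow> u = t \<and> s'' = s'"
proof (induction arbitrary: u s'' rule: exec.induct)
  case (Skip s)
  then show ?case by (elim exec_SkipE) simp
next
  case (Assign x e s)
  then show ?case by (elim exec_AssignE) simp
next
  case (Store r es e s)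
  then show ?case by (elim exec_StoreE) simp
next
  case (Seq p s t s1 q u1 s2)
  from Seq.prems obtain t' s1' u' where
    "(p, s) \<Rightarrow>[t'] s1'" "(q, s1') \<Rightarrow>[u'] s''" "u = 1 + t' + u'"
    by (elim exec_SeqE) simp
  with Seq.IH show ?case by metis
next
  case (IfTrue s b p t s1 q)
  from IfTrue.prems IfTrue.hyps(1) obtain t' where "(p, s) \<Rightarrow>[t'] s''" "u = 1 + bcost b + t'"
    by (elim exec_IfE) simp_all
  with IfTrue.IH show ?case by metis
next
  case (IfFalse s b q t s1 p)
  from IfFalse.prems IfFalse.hyps(1) obtain t' where "(q, s) \<Rightarrow>[t'] s''" "u = 1 + bcost b + t'"
    by (elim exec_IfE) simp_all
  with IfFalse.IH show ?case by metis
next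
  case (WhileFalse s b p)
  then show ?case by - (erule exec_WhileE, simp_all)
next
  case (WhileTrue s b p t s1 u1 s2)
  from WhileTrue.prems WhileTrue.hyps(1) obtain t' s1' u' where
    "(p, s) \<Rightarrow>[t'] s1'" "(WHILE b DO p, s1') \<Rightarrow>[u'] s''" "u = 1 + bcost b + t' + u'"
    by - (erule exec_WhileE, simp_all)
  with WhileTrue.IH show ?case by metis
qed

section \<open>The implementation\<close>

datatype var = NApp | PolLen | App | Crs | Cur | Nxt | K | J | Head | Size | Ok | Done

text \<open>
  Input arrays: capacities \<open>CapA\<close> and \<open>CapC\<close>, policy \<open>Pol\<close>, preference lists \<open>Pref\<close> with lengths
  \<open>PrefLen\<close>, and lists \<open>Imm\<close> of immediate prerequisites with lengths \<open>ImmLen\<close>.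
  Work arrays: list pointers \<open>Ptr\<close>, bundles \<open>Bundle\<close> with sizes \<open>BundleLen\<close> and membership flags
  \<open>InBundle\<close>, numbers \<open>Occ\<close> of applicants assigned to the courses, and a queue \<open>Queue\<close> with
  membership flags \<open>Mark\<close>.
\<close>

datatype arr = CapA | CapC | Pol | PrefLen | Pref | ImmLen | Imm
  | Ptr | Bundle | BundleLen | InBundle | Occ | Queue | Mark

abbreviation incr :: "var \<Rightarrow> (var, arr) com" where
  "incr x \<equiv> x ::= Plus (Var x) (Lit 1)"

abbreviation incr_at :: "arr \<Rightarrow> (var, arr) exp list \<Rightarrow> (var, arr) com" where
  "incr_at r es \<equiv> r \<langle>es\<rangle> ::= Plus (Rd r es) (Lit 1)"

definition init_prog :: "(var, arr) com" where
  "init_prog =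
     App ::= Lit 0;;
     WHILE Less (Var App) (Var NApp) DO (
       Ptr \<langle>[Var App]\<rangle> ::= Lit 0;;
       BundleLen \<langle>[Var App]\<rangle> ::= Lit 0;;
       J ::= Lit 0;;
       WHILE Less (Var J) (Rd PrefLen [Var App]) DO (
         Crs ::= Rd Pref [Var App, Var J];;
         Occ \<langle>[Var Crs]\<rangle> ::= Lit 0;;
         Mark \<langle>[Var Crs]\<rangle> ::= Lit 0;;
         InBundle \<langle>[Var App, Var Crs]\<rangle> ::= Lit 0;;
         incr J
       );;
       incr App
     )"

text \<open>
  Breadth-first search from \<open>Crs\<close> along immediate prerequisites, not entering the current
  bundle: collects the courses to be added in \<open>Queue\<close> and clears \<open>Ok\<close> if one of them is full.
\<close>

definition collect_prog :: "(var, arr) com" where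
  "collect_prog =
     Queue \<langle>[Lit 0]\<rangle> ::= Var Crs;;
     Mark \<langle>[Var Crs]\<rangle> ::= Lit 1;;
     Size ::= Lit 1;;
     Ok ::= Lit 1;;
     Head ::= Lit 0;;
     WHILE Less (Var Head) (Var Size) DO (
       Cur ::= Rd Queue [Var Head];;
       (IF Eq (Rd Occ [Var Cur]) (Rd CapC [Var Cur]) THEN Ok ::= Lit 0 ELSE SKIP);;
       J ::= Lit 0;;
       WHILE Less (Var J) (Rd ImmLen [Var App, Var Cur]) DO (
         Nxt ::= Rd Imm [Var App, Var Cur, Var J];;
         (IF And (Eq (Rd Mark [Var Nxt]) (Lit 0)) (Eq (Rd InBundle [Var App, Var Nxt]) (Lit 0))
          THEN
            Queue \<langle>[Var Size]\<rangle> ::= Var Nxt;;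
            Mark \<langle>[Var Nxt]\<rangle> ::= Lit 1;;
            incr Size
          ELSE SKIP);;
         incr J
       );;
       incr Head
     )"

definition add_prog :: "(var, arr) com" where
  "add_prog =
     Head ::= Lit 0;;
     WHILE Less (Var Head) (Var Size) DO (
       Cur ::= Rd Queue [Var Head];;
       Bundle \<langle>[Var App, Rd BundleLen [Var App]]\<rangle> ::= Var Cur;;
       incr_at BundleLen [Var App];;
       InBundle \<langle>[Var App, Var Cur]\<rangle> ::= Lit 1;;
       incr_at Occ [Var Cur];;
       incr Head
     );;
     Done ::= Lit 1"

definition unmark_prog :: "(var, arr) com" where
  "unmark_prog =
     Head ::= Lit 0;;
     WHILE Less (Var Head) (Var Size) DO (
       Mark \<langle>[Rd Queue [Var Head]]\<rangle> ::= Lit 0;;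
       incr Head
     )"

definition turn_prog :: "(var, arr) com" where
  "turn_prog =
     Done ::= Lit 0;;
     WHILE And (Eq (Var Done) (Lit 0)) (Less (Rd Ptr [Var App]) (Rd PrefLen [Var App])) DO (
       Crs ::= Rd Pref [Var App, Rd Ptr [Var App]];;
       incr_at Ptr [Var App];;
       IF And (Eq (Rd InBundle [Var App, Var Crs]) (Lit 0)) (Less (Rd Occ [Var Crs]) (Rd CapC [Var Crs]))
       THEN
         collect_prog;;
         (IF And (Eq (Var Ok) (Lit 1))
              (Less (Plus (Rd BundleLen [Var App]) (Var Size)) (Plus (Rd CapA [Var App]) (Lit 1)))
          THEN add_prog ELSE SKIP);;
         unmark_prog
       ELSE SKIP
     )"

definition sm_capr_prog :: "(var, arr) com" where
  "sm_capr_prog =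
     init_prog;;
     K ::= Lit 0;;
     WHILE Less (Var K) (Var PolLen) DO (
       App ::= Rd Pol [Var K];;
       turn_prog;;
       incr K
     )"

text \<open>
  Nothing is assumed about the initial contents of the work arrays and of the memory cells outside
  the given ranges. Immediate prerequisites are listed without repetition, in arbitrary order.
\<close>

definition input_store :: "capr \<Rightarrow> nat list \<Rightarrow> (var, arr) store \<Rightarrow> bool" where
  "input_store I \<sigma> s \<longleftrightarrow>
     vars s NApp = napp I \<and>
     vars s PolLen = length \<sigma> \<and>
     (\<forall>k<length \<sigma>. arrs s Pol [k] = \<sigma> ! k) \<and>
     (\<forall>c<ncrs I. arrs s CapC [c] = capC I c) \<and>
     (\<forall>a<napp I.
        arrs s CapA [a] = capA I a \<and>
        arrs s PrefLen [a] = length (pref I a) \<and>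
        (\<forall>k<length (pref I a). arrs s Pref [a, k] = pref I a ! k) \<and>
        (\<forall>c<ncrs I.
           arrs s ImmLen [a, c] = card (immediate I a c) \<and>
           bij_betw (\<lambda>k. arrs s Imm [a, c, k]) {..<card (immediate I a c)} (immediate I a c)))"

definition output_matching :: "capr \<Rightarrow> (var, arr) store \<Rightarrow> (nat \<times> nat) set" where
  "output_matching I s =
     {(a, arrs s Bundle [a, k]) | a k. a < napp I \<and> k < arrs s BundleLen [a]}"

definition total_capacity :: "capr \<Rightarrow> nat" where
  "total_capacity I = (\<Sum>a<napp I. capA I a)"

definition total_pref_length :: "capr \<Rightarrow> nat" where
  "total_pref_length I = (\<Sum>a<napp I. length (pref I a))"

definition total_immediate :: "capr \<Rightarrow> nat" where
  "total_immediate I = (\<Sum>a<napp I. \<Sum>c<ncrs I. card (immediate I a c))"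

text \<open>
  The size measure of the time bound is \<open>total_capacity I + ncrs I * (total_pref_length I + total_immediate I)\<close>.
  It is positive as soon as there is an applicant and \<open>0\<close> otherwise; taking its maximum with
  \<open>1\<close> only accounts for the constant time needed when there are no applicants.
\<close>

end

theory Submission
  imports Defs
begin

text \<open>
  Pareto optimality: let \<open>M'\<close> be a matching that dominates the output. By induction along the run,
  every intermediate matching is contained in \<open>M'\<close>, and \<open>M'\<close> gives an applicant no course
  rejected so far: a rejection is caused by a full course or by lack of capacity, and both obstacles
  persist in every larger matching. If a served course were missing in \<open>M'\<close>, then \<open>M'\<close> would by
  lexicographic preference contain a higher ranked course that had been rejected. When every
  applicant is saturated or has exhausted her list, \<open>M'\<close> is therefore the output itself.

  Running time: one attempt costs a breadth-first search over at most \<open>ncrs I\<close> courses along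
  at most all immediate prerequisites of the applicant. The number of attempts of an applicant is
  at most the length of her list, and hence also at most \<open>ncrs I\<close>; the two bounds are used for the
  number of courses and for the number of immediate prerequisites respectively.
\<close>

section \<open>The abstract algorithm\<close>

text \<open>Domination compares \<open>M'\<close> with the final output only, whereas the induction
  meets intermediate matchings. The hypothesis about higher ranked courses is therefore stated for a
  fixed set \<open>F\<close> that contains all matchings met, and \<open>F\<close> is instantiated
  with the output at the end.

  Two points shape the invariants of the program. The work arrays start with arbitrary contents and
  are cleared only in the cells of acceptable courses, so the representation speaks of those cells
  alone; this suffices because prerequisites of acceptable courses are acceptable. Moreover, a
  single turn may read an entire preference list, so turns are not bounded one by one: the unread
  parts of the lists form a potential that pays for all attempts. The numerical constants are
  generous roundings of step counts.\<close>

definition gain :: "capr \<Rightarrow> (nat \<times> nat) set \<Rightarrow> nat \<Rightarrow> nat \<Rightarrow> nat set" where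
  "gain I M a c = prereq_closure I a c - bundle_of M a"

text \<open>The separate test of \<open>c\<close> in \<open>turn\<close> is absorbed: a course
  outside the bundle belongs to its own gain, so the test over the gain covers it.\<close>

definition accepts :: "capr \<Rightarrow> (nat \<times> nat) set \<Rightarrow> nat \<Rightarrow> nat \<Rightarrow> bool" where
  "accepts I M a c \<longleftrightarrow> c \<notin> bundle_of M a \<and> (\<forall>d\<in>gain I M a c. \<not> full I M d) \<and>
     card (bundle_of M a) + card (gain I M a c) \<le> capA I a"

lemma self_in_gain: "c \<notin> bundle_of M a \<Longrightarrow> c \<in> gain I M a c"
  by (simp add: gain_def prereq_closure_def)

lemma turn_Cons:
  "turn I a (c # cs) M =
     (if accepts I M a c then (cs, M \<union> {a} \<times> gain I M a c) else turn I a cs M)"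
  using self_in_gain[of c M a I] by (auto simp: accepts_def gain_def Let_def)

declare turn.simps(2) [simp del]

text \<open>The matching does not change while a turn skips courses, so all rejections of a turn
  refer to the same \<open>M\<close>. This lets later proofs treat a turn as one event.\<close>

lemma turn_cases:
  obtains (exhausted) "turn I a cs M = ([], M)" "\<And>c. c \<in> set cs \<Longrightarrow> \<not> accepts I M a c"
  | (served) xs c ys where "cs = xs @ c # ys" "accepts I M a c"
      "\<And>x. x \<in> set xs \<Longrightarrow> \<not> accepts I M a x" "turn I a cs M = (ys, M \<union> {a} \<times> gain I M a c)"
proof -
  have "(turn I a cs M = ([], M) \<and> (\<forall>c\<in>set cs. \<not> accepts I M a c)) \<or>
    (\<exists>xs c ys. cs = xs @ c # ys \<and> accepts I M a c \<and> (\<forall>x\<in>set xs. \<not> accepts I M a x) \<and>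
       turn I a cs M = (ys, M \<union> {a} \<times> gain I M a c))"
  proof (induction cs)
    case (Cons c cs)
    show ?case
    proof (cases "accepts I M a c")
      case True
      then show ?thesis by (intro disjI2 exI[of _ "[]"]) (simp add: turn_Cons)
    next
      case False
      from Cons.IH show ?thesis
      proof (elim disjE exE conjE)
        fix xs d ys
        assume "cs = xs @ d # ys" "accepts I M a d" "\<forall>x\<in>set xs. \<not> accepts I M a x"
          "turn I a cs M = (ys, M \<union> {a} \<times> gain I M a d)"
        then show ?thesis
          using False by (intro disjI2 exI[of _ "c # xs"] exI[of _ d] exI[of _ ys]) (simp add: turn_Cons)
      qed (use False in \<open>simp add: turn_Cons\<close>)
    qed
  qed simp
  then show ?thesis using that by blast
qed

section \<open>Enlarging a matching by a gain\<close>

lemma bundle_of_serve: "bundle_of (M \<union> {a} \<times> X) b = bundle_of M b \<union> (if b = a then X else {})"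
  by auto

lemma assigned_to_serve:
  "assigned_to (M \<union> {a} \<times> X) c = (if c \<in> X then insert a (assigned_to M c) else assigned_to M c)"
  by auto

lemma matching_finite:
  assumes "matching I M"
  shows "finite (bundle_of M a)" "finite (assigned_to M c)"
proof -
  have "finite M"
    using assms finite_subset[of M "{..<napp I} \<times> {..<ncrs I}"] by (simp add: matching_def)
  then show "finite (bundle_of M a)" "finite (assigned_to M c)"
    by (simp_all add: finite_Image)
qed

lemma capr_instanceD:
  assumes "capr_instance I" "a < napp I"
  shows "0 < capA I a" "distinct (pref I a)" "set (pref I a) \<subseteq> {..<ncrs I}"
    "prereq I a \<subseteq> {..<ncrs I} \<times> {..<ncrs I}" "irrefl (prereq I a)" "trans (prereq I a)"
    "c \<in> set (pref I a) \<Longrightarrow> prereq_closure I a c \<subseteq> set (pref I a)"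
  using assms by (simp_all add: capr_instance_def)

lemma matchingD:
  assumes "matching I M" "a < napp I"
  shows "bundle_of M a \<subseteq> set (pref I a)" "card (bundle_of M a) \<le> capA I a"
    "c \<in> bundle_of M a \<Longrightarrow> prereq_closure I a c \<subseteq> bundle_of M a"
proof -
  have "feasible I a (bundle_of M a)" using assms unfolding matching_def by blast
  then show "bundle_of M a \<subseteq> set (pref I a)" "card (bundle_of M a) \<le> capA I a"
    "c \<in> bundle_of M a \<Longrightarrow> prereq_closure I a c \<subseteq> bundle_of M a"
    unfolding feasible_def prereq_closure_def by blast+
qed

lemma gain_subset_pref:
  assumes "capr_instance I" "a < napp I" "c \<in> set (pref I a)"
  shows "gain I M a c \<subseteq> set (pref I a)"
  using capr_instanceD(7)[OF assms] by (auto simp: gain_def)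

text \<open>Closure under prerequisites comes from transitivity: a prerequisite of a gained course
  lies in the closure of \<open>c\<close>, hence in the gain or already in the bundle. Each gained
  course has a free place, since it is not full and \<open>M\<close> respects its capacity.\<close>

lemma matching_serve:
  assumes I: "capr_instance I" and M: "matching I M" and a: "a < napp I"
    and c: "c \<in> set (pref I a)" and acc: "accepts I M a c"
  shows "matching I (M \<union> {a} \<times> gain I M a c)"
  unfolding matching_def
proof (intro conjI allI impI)
  let ?S = "gain I M a c"
  have S: "?S \<subseteq> set (pref I a)" by (rule gain_subset_pref[OF I a c])
  then have Sn: "?S \<subseteq> {..<ncrs I}" using capr_instanceD(3)[OF I a] by blast
  show "M \<union> {a} \<times> ?S \<subseteq> {..<napp I} \<times> {..<ncrs I}"
    using M a Sn by (auto simp: matching_def)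
  show "feasible I b (bundle_of (M \<union> {a} \<times> ?S) b)" if b: "b < napp I" for b
  proof (cases "b = a")
    case True
    have "card (bundle_of M a \<union> ?S) \<le> capA I a"
      using acc card_Un_le[of "bundle_of M a" ?S] unfolding accepts_def by linarith
    moreover have "d \<in> bundle_of M a \<union> ?S" if "e \<in> bundle_of M a \<union> ?S" "(e, d) \<in> prereq I a" for d e
    proof (cases "e \<in> bundle_of M a")
      case True
      then show ?thesis using matchingD(3)[OF M a True] that by (auto simp: prereq_closure_def)
    next
      case False
      with that have "e \<in> prereq_closure I a c" by (auto simp: gain_def)
      with that have "d \<in> prereq_closure I a c"
        using transD[OF capr_instanceD(6)[OF I a], of c e d] by (auto simp: prereq_closure_def)
      then show ?thesis by (auto simp: gain_def)
    qed
    ultimately show ?thesis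
      using S matchingD(1)[OF M a] unfolding True bundle_of_serve feasible_def by auto
  next
    case False
    then show ?thesis using M b unfolding bundle_of_serve by (simp add: matching_def)
  qed
  show "card (assigned_to (M \<union> {a} \<times> ?S) d) \<le> capC I d" if d: "d < ncrs I" for d
  proof -
    have le: "card (assigned_to M d) \<le> capC I d" using M d by (simp add: matching_def)
    show ?thesis
    proof (cases "d \<in> ?S")
      case True
      then have "card (assigned_to M d) < capC I d"
        using le acc by (fastforce simp: accepts_def full_def)
      then show ?thesis
        unfolding assigned_to_serve
        using True card_insert_le_m1[of "capC I d" "assigned_to M d" a]
        by (simp add: card_insert_if matching_finite[OF M])
    next
      case False
      then show ?thesis unfolding assigned_to_serve using le by simp
    qed
  qed
qed

text \<open>Along with \<open>c\<close>, \<open>M'\<close> contains the whole gain. A full course of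
  the gain would then receive \<open>a\<close> as an additional applicant, and a gain too large for
  the quota would overfill the bundle of \<open>a\<close>.\<close>

lemma rejected_course:
  assumes M: "matching I M" and M': "matching I M'" and sub: "M \<subseteq> M'" and a: "a < napp I"
    and rej: "\<not> accepts I M a c" and c: "c \<in> bundle_of M' a"
  shows "c \<in> bundle_of M a"
proof (rule ccontr)
  assume nc: "c \<notin> bundle_of M a"
  have gain: "gain I M a c \<subseteq> bundle_of M' a - bundle_of M a"
    using matchingD(3)[OF M' a c] by (auto simp: gain_def)
  from rej nc consider d where "d \<in> gain I M a c" "full I M d"
    | "card (bundle_of M a) + card (gain I M a c) > capA I a"
    by (auto simp: accepts_def)
  then show False
  proof cases
    case 1
    then have d: "(a, d) \<in> M'" "(a, d) \<notin> M" using gain by auto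
    then have "d < ncrs I" using M' by (auto simp: matching_def)
    then have "card (assigned_to M' d) \<le> capC I d" using M' by (simp add: matching_def)
    moreover have "assigned_to M d \<subset> assigned_to M' d" using d sub by blast
    then have "card (assigned_to M d) < card (assigned_to M' d)"
      by (rule psubset_card_mono[OF matching_finite(2)[OF M']])
    ultimately show False using 1 by (simp add: full_def)
  next
    case 2
    have "card (bundle_of M a \<union> gain I M a c) = card (bundle_of M a) + card (gain I M a c)"
      using gain by (intro card_Un_disjoint matching_finite[OF M] finite_subset[OF gain])
        (auto simp: matching_finite[OF M'])
    moreover have "card (bundle_of M a \<union> gain I M a c) \<le> card (bundle_of M' a)"
      using gain sub by (intro card_mono matching_finite[OF M']) blast
    ultimately show False using 2 matchingD(2)[OF M' a] by linarith
  qed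
qed

section \<open>Invariants along a run\<close>

definition step :: "capr \<Rightarrow> nat \<Rightarrow> (nat \<Rightarrow> nat list) \<times> (nat \<times> nat) set \<Rightarrow>
    (nat \<Rightarrow> nat list) \<times> (nat \<times> nat) set" where
  "step I a = (\<lambda>(r, M). let (cs, M') = turn I a (r a) M in (r(a := cs), M'))"

text \<open>Unlike \<open>run\<close>, the fold keeps the pointers, on which the invariants depend,
  and it can be split at the last entry of the policy.\<close>

lemma run_eq_fold: "run I \<sigma> r M = snd (fold (step I) \<sigma> (r, M))"
  by (induction \<sigma> arbitrary: r M) (auto simp: step_def split: prod.split)

definition valid_state :: "capr \<Rightarrow> (nat \<Rightarrow> nat list) \<times> (nat \<times> nat) set \<Rightarrow> bool" where
  "valid_state I = (\<lambda>(r, M). matching I M \<and> (\<forall>a<napp I. \<exists>n. r a = drop n (pref I a)))"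

lemma valid_state_init: "valid_state I (pref I, {})"
  by (auto simp: valid_state_def matching_def feasible_def intro: exI[of _ 0])

lemma valid_state_pref_subset:
  "valid_state I (r, M) \<Longrightarrow> a < napp I \<Longrightarrow> set (r a) \<subseteq> set (pref I a)"
  using set_drop_subset by (fastforce simp: valid_state_def)

lemma valid_state_step:
  assumes I: "capr_instance I" and a: "a < napp I" and v: "valid_state I (r, M)"
  shows "valid_state I (step I a (r, M))"
proof -
  from v a obtain n where n: "r a = drop n (pref I a)" by (auto simp: valid_state_def)
  show ?thesis
  proof (cases rule: turn_cases[of I a "r a" M])
    case exhausted
    then show ?thesis
      using v by (auto simp: valid_state_def step_def intro: exI[of _ "length (pref I a)"])
  next
    case (served xs c ys)
    have "ys = drop (n + Suc (length xs)) (pref I a)"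
      using arg_cong[OF served(1), of "drop (Suc (length xs))"] n by (simp add: add.commute)
    moreover have "c \<in> set (pref I a)"
      using valid_state_pref_subset[OF v a] served(1) by auto
    ultimately show ?thesis
      using v a served matching_serve[OF I _ a, of M c]
      by (auto simp: valid_state_def step_def)
  qed
qed

lemma valid_state_fold:
  "capr_instance I \<Longrightarrow> set \<sigma> \<subseteq> {..<napp I} \<Longrightarrow> valid_state I x \<Longrightarrow> valid_state I (fold (step I) \<sigma> x)"
proof (induction \<sigma> arbitrary: x)
  case (Cons a \<sigma>)
  then show ?case using valid_state_step[of I a "fst x" "snd x"] by simp
qed simp

lemma step_mono: "snd x \<subseteq> snd (step I a x)"
proof (cases x)
  case (Pair r M)
  show ?thesis
    by (cases rule: turn_cases[of I a "r a" M]) (auto simp: Pair step_def)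
qed

lemma fold_step_mono: "snd x \<subseteq> snd (fold (step I) \<sigma> x)"
proof (induction \<sigma> arbitrary: x)
  case (Cons a \<sigma>)
  then show ?case using order_trans[OF step_mono[of x I a]] by simp
qed simp

text \<open>An applicant who has not exhausted her list gets a new course on each of her turns.\<close>

lemma bundle_size_ge_turns:
  assumes I: "capr_instance I" and \<sigma>: "set \<sigma> \<subseteq> {..<napp I}"
    and x: "fold (step I) \<sigma> (pref I, {}) = (r, M)"
  shows "r a = [] \<or> count_list \<sigma> a \<le> card (bundle_of M a)"
  using \<sigma> x
proof (induction \<sigma> arbitrary: r M rule: rev_induct)
  case (snoc b \<sigma>)
  obtain r1 M1 where 1: "fold (step I) \<sigma> (pref I, {}) = (r1, M1)" by fastforce
  then have v: "valid_state I (r1, M1)"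
    using valid_state_fold[OF I _ valid_state_init, of \<sigma>] snoc.prems by simp
  then have M1: "matching I M1" by (simp add: valid_state_def)
  from 1 snoc.prems have x: "step I b (r1, M1) = (r, M)" by simp
  from snoc 1 have IH: "r1 a = [] \<or> count_list \<sigma> a \<le> card (bundle_of M1 a)" by simp
  have b: "b < napp I" using snoc.prems by simp
  have v2: "valid_state I (r, M)" using valid_state_step[OF I b v] x by simp
  then have fin: "finite (bundle_of M a)" by (auto simp: valid_state_def intro: matching_finite)
  show ?case
  proof (cases "b = a")
    case True
    show ?thesis
    proof (cases rule: turn_cases[of I a "r1 a" M1])
      case exhausted
      then show ?thesis using x True by (auto simp: step_def)
    next
      case (served xs c ys)
      then have M: "M = M1 \<union> {a} \<times> gain I M1 a c" using x True by (auto simp: step_def)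
      have "c \<in> gain I M1 a c" "c \<notin> bundle_of M1 a"
        using served(2) by (auto simp: accepts_def self_in_gain)
      then have "bundle_of M1 a \<subset> bundle_of M a" unfolding M by auto
      then have "card (bundle_of M1 a) < card (bundle_of M a)"
        by (rule psubset_card_mono[OF fin])
      then show ?thesis using IH served(1) True by auto
    qed
  next
    case False
    have "card (bundle_of M1 a) \<le> card (bundle_of M a)"
      using step_mono[of "(r1, M1)" I b] x by (intro card_mono fin) auto
    moreover have "r a = r1 a" using x False by (auto simp: step_def split: prod.splits)
    ultimately show ?thesis using IH False by auto
  qed
qed simp

section \<open>Comparison with a dominating matching\<close>

lemma highest_ranked:
  assumes "X \<subseteq> set (pref I a)" "X \<noteq> {}"
  shows "\<exists>c\<in>X. \<forall>d\<in>X. d \<noteq> c \<longrightarrow> ranks_above I a c d"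
proof -
  let ?P = "\<lambda>i. i < length (pref I a) \<and> pref I a ! i \<in> X"
  from assms have ex: "\<exists>i. ?P i" by (metis all_not_in_conv in_set_conv_nth subsetD)
  let ?i = "LEAST i. ?P i"
  from ex have i: "?P ?i" by (rule LeastI_ex)
  have "ranks_above I a (pref I a ! ?i) d" if d: "d \<in> X" "d \<noteq> pref I a ! ?i" for d
  proof -
    from d assms obtain j where j: "j < length (pref I a)" "pref I a ! j = d"
      by (metis in_set_conv_nth subsetD)
    with d have "?i \<le> j" by (intro Least_le) simp
    moreover from j d have "?i \<noteq> j" by metis
    ultimately have "?i < j" by simp
    with j show ?thesis unfolding ranks_above_def by blast
  qed
  with i show ?thesis by blast
qed

text \<open>Rejections are not recorded in the state. A course that is no longer ahead of the
  pointer and is absent from \<open>M\<close> stands for a rejected one.\<close>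

definition below :: "capr \<Rightarrow> (nat \<times> nat) set \<Rightarrow> (nat \<Rightarrow> nat list) \<times> (nat \<times> nat) set \<Rightarrow> bool" where
  "below I M' = (\<lambda>(r, M). M \<subseteq> M' \<and>
     (\<forall>a<napp I. \<forall>c\<in>set (pref I a). c \<notin> set (r a) \<longrightarrow> (a, c) \<in> M' \<longrightarrow> (a, c) \<in> M))"

text \<open>The only way to leave \<open>M'\<close> would be to serve a course \<open>c\<close>
  missing there. Then \<open>higher\<close> yields a course of \<open>M'\<close> outside
  \<open>F\<close> that ranks above \<open>c\<close>. The pointer has passed it, so it already lies
  in \<open>M\<close>, contradicting \<open>M \<subseteq> F\<close>.\<close>

lemma below_step:
  assumes I: "capr_instance I" and a: "a < napp I" and v: "valid_state I (r, M)"
    and M': "matching I M'" and bel: "below I M' (r, M)" and F: "snd (step I a (r, M)) \<subseteq> F"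
    and higher: "\<And>c. c \<in> bundle_of F a \<Longrightarrow> c \<notin> bundle_of M' a \<Longrightarrow>
      \<exists>d. ranks_above I a d c \<and> d \<in> bundle_of M' a \<and> d \<notin> bundle_of F a"
  shows "below I M' (step I a (r, M))"
proof -
  have M: "matching I M" using v by (simp add: valid_state_def)
  have sub: "M \<subseteq> M'" using bel by (simp add: below_def)
  note rej = rejected_course[OF M M' sub a]
  show ?thesis
  proof (cases rule: turn_cases[of I a "r a" M])
    case exhausted
    have "(a, c) \<in> M" if "c \<in> set (pref I a)" "(a, c) \<in> M'" for c
      using that bel a rej[of c] exhausted(2)[of c] by (cases "c \<in> set (r a)") (auto simp: below_def)
    then show ?thesis using bel exhausted(1) by (simp add: below_def step_def)
  next
    case (served xs c ys)
    let ?N = "M \<union> {a} \<times> gain I M a c"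
    have step: "step I a (r, M) = (r(a := ys), ?N)" using served(4) by (simp add: step_def)
    \<comment> \<open>Such a course was either passed in an earlier turn, where the invariant
      applies, or rejected in this one, where \<open>rej\<close> applies.\<close>
    have passed: "(a, d) \<in> M" if "d \<in> set (pref I a)" "d \<notin> set (c # ys)" "(a, d) \<in> M'" for d
      using that bel a rej[of d] served(1) served(3)[of d]
      by (cases "d \<in> set xs") (auto simp: below_def)
    have cM': "c \<in> bundle_of M' a"
    proof (rule ccontr)
      assume "c \<notin> bundle_of M' a"
      moreover have "c \<in> bundle_of F a"
        using F served(2) self_in_gain[of c M a I] unfolding step by (auto simp: accepts_def)
      ultimately obtain d where d: "ranks_above I a d c" "d \<in> bundle_of M' a" "d \<notin> bundle_of F a"
        using higher by blast
      from d(1) obtain i j where ij: "i < j" "j < length (pref I a)" "pref I a ! i = d" "pref I a ! j = c"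
        by (auto simp: ranks_above_def)
      from v a obtain n where n: "r a = drop n (pref I a)" by (auto simp: valid_state_def)
      define zs where "zs = take n (pref I a) @ xs"
      have p: "pref I a = zs @ c # ys"
        using n served(1) by (metis append.assoc append_take_drop_id zs_def)
      have dist: "distinct (zs @ c # ys)" using capr_instanceD(2)[OF I a] p by simp
      \<comment> \<open>Since the list has no repetitions, \<open>c\<close> occurs at this position
        only; whatever ranks above \<open>c\<close> lies in \<open>zs\<close>.\<close>
      have "j = length zs"
        using ij(2,4) nth_eq_iff_index_eq[OF dist, of j "length zs"] unfolding p by simp
      then have dz: "d \<in> set zs" using ij(1,3) unfolding p by (auto simp: nth_append)
      then have "(a, d) \<in> M" using passed[of d] d(2) dist p by auto
      then show False using d(3) F unfolding step by auto
    qed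
    have "gain I M a c \<subseteq> bundle_of M' a"
      using matchingD(3)[OF M' a cM'] by (auto simp: gain_def)
    then have "?N \<subseteq> M'" using sub by auto
    moreover have "(a, d) \<in> ?N" if "d \<in> set (pref I a)" "d \<notin> set ys" "(a, d) \<in> M'" for d
      using passed[of d] that served(2) self_in_gain[of c M a I]
      by (cases "d = c") (auto simp: accepts_def)
    ultimately show ?thesis using bel unfolding step by (auto simp: below_def)
  qed
qed

lemma below_fold:
  assumes I: "capr_instance I" and "set \<sigma> \<subseteq> {..<napp I}" and M': "matching I M'"
    and higher: "\<And>a c. a < napp I \<Longrightarrow> c \<in> bundle_of F a \<Longrightarrow> c \<notin> bundle_of M' a \<Longrightarrow>
      \<exists>d. ranks_above I a d c \<and> d \<in> bundle_of M' a \<and> d \<notin> bundle_of F a"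
    and "valid_state I x" "below I M' x" "snd (fold (step I) \<sigma> x) \<subseteq> F"
  shows "below I M' (fold (step I) \<sigma> x)"
  using assms(2,5-)
proof (induction \<sigma> arbitrary: x)
  case (Cons a \<sigma>)
  obtain r M where x: "x = (r, M)" by fastforce
  have a: "a < napp I" using Cons.prems by simp
  have "snd (step I a x) \<subseteq> F"
    using Cons.prems(4) fold_step_mono[of "step I a x" I \<sigma>] by simp
  then have "below I M' (step I a x)"
    using below_step[OF I a _ M', of r M F] Cons.prems(2,3) higher[OF a] unfolding x by blast
  moreover have "valid_state I (step I a x)"
    using valid_state_step[OF I a, of r M] Cons.prems(2) x by simp
  ultimately show ?case using Cons by simp
qed simp

text \<open>Once \<open>M \<subseteq> M'\<close> is known, an applicant who is better off in
  \<open>M'\<close> has spare capacity in \<open>M\<close> and an unread course that would be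
  accepted. Hypothesis \<open>full\<close> excludes this.\<close>

lemma pareto_optimal_run:
  assumes I: "capr_instance I" and \<sigma>: "set \<sigma> \<subseteq> {..<napp I}"
    and x: "fold (step I) \<sigma> (pref I, {}) = (r, M)"
    and full: "\<And>a. a < napp I \<Longrightarrow> count_list \<sigma> a = capA I a \<or> snd (step I a (r, M)) = M"
  shows "pareto_optimal I M"
proof -
  have "valid_state I (r, M)"
    using valid_state_fold[OF I \<sigma> valid_state_init] x by simp
  then have M: "matching I M" by (simp add: valid_state_def)
  have False if M': "matching I M'" and dom: "dominates I M' M" for M'
  proof -
    have higher: "\<exists>d. ranks_above I a d c \<and> d \<in> bundle_of M' a \<and> d \<notin> bundle_of M a"
      if a: "a < napp I" and c: "c \<in> bundle_of M a" "c \<notin> bundle_of M' a" for a c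
    proof -
      let ?D = "(bundle_of M a - bundle_of M' a) \<union> (bundle_of M' a - bundle_of M a)"
      have "?D \<subseteq> set (pref I a)" "?D \<noteq> {}"
        using matchingD(1)[OF M a] matchingD(1)[OF M' a] c by auto
      then obtain d where d: "d \<in> ?D" "\<forall>e\<in>?D. e \<noteq> d \<longrightarrow> ranks_above I a d e"
        using highest_ranked by meson
      \<comment> \<open>By domination the highest ranked course of the symmetric difference cannot
        belong to \<open>M\<close>, so it belongs to \<open>M'\<close> and ranks above
        \<open>c\<close>.\<close>
      have "\<not> lex_prefers I a (bundle_of M a) (bundle_of M' a)"
        using dom a by (auto simp: dominates_def)
      then have "d \<notin> bundle_of M a"
        using d unfolding lex_prefers_def by blast
      moreover from this d c have "ranks_above I a d c" by auto
      ultimately show ?thesis using d(1) by blast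
    qed
    have "below I M' (r, M)"
      using below_fold[OF I \<sigma> M' higher valid_state_init] x by (simp add: below_def)
    then have sub: "M \<subseteq> M'" and passed: "\<And>a c. a < napp I \<Longrightarrow> c \<in> set (pref I a) \<Longrightarrow> c \<notin> set (r a) \<Longrightarrow>
        (a, c) \<in> M' \<Longrightarrow> (a, c) \<in> M"
      by (auto simp: below_def)
    from dom obtain a where a: "a < napp I" "lex_prefers I a (bundle_of M' a) (bundle_of M a)"
      by (auto simp: dominates_def)
    then have "bundle_of M' a \<noteq> bundle_of M a" by (auto simp: lex_prefers_def)
    with sub obtain d where d: "d \<in> bundle_of M' a" "d \<notin> bundle_of M a" by blast
    then have "bundle_of M a \<subset> bundle_of M' a" using sub by blast
    then have "card (bundle_of M a) < card (bundle_of M' a)"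
      by (rule psubset_card_mono[OF matching_finite(1)[OF M']])
    then have "card (bundle_of M a) < capA I a" using matchingD(2)[OF M' a(1)] by simp
    \<comment> \<open>With \<open>capA I a\<close> turns and an unexhausted list the quota would be
      filled.\<close>
    then have "r a = [] \<or> snd (step I a (r, M)) = M"
      using bundle_size_ge_turns[OF I \<sigma> x, of a] full[OF a(1)] by auto
    \<comment> \<open>By \<open>rejected_course\<close> only an acceptable attempt can be missing
      from \<open>M\<close>, and by \<open>passed\<close> the course is still ahead of the pointer;
      hence another turn would serve some course.\<close>
    moreover have "accepts I M a d" using rejected_course[OF M M' sub a(1)] d by blast
    moreover have "d \<in> set (r a)" using passed[OF a(1), of d] d matchingD(1)[OF M' a(1)] by blast
    ultimately have "snd (turn I a (r a) M) = M"
      by (auto simp: step_def split: prod.splits)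
    then show False
    proof (cases rule: turn_cases[of I a "r a" M])
      case exhausted
      then show ?thesis using \<open>accepts I M a d\<close> \<open>d \<in> set (r a)\<close> by blast
    next
      case (served xs c ys)
      then have "c \<in> gain I M a c" "c \<notin> bundle_of M a" by (auto simp: accepts_def self_in_gain)
      then show ?thesis using served(4) \<open>snd (turn I a (r a) M) = M\<close> by auto
    qed
  qed
  with M show ?thesis by (auto simp: pareto_optimal_def)
qed

section \<open>Program logic and state representation\<close>

text \<open>A total-correctness weakest precondition whose postcondition also sees the running time.
  Asking for one run is enough because execution is deterministic.\<close>

definition wp :: "('v, 'r) com \<Rightarrow> ('v, 'r) store \<Rightarrow> (nat \<Rightarrow> ('v, 'r) store \<Rightarrow> bool) \<Rightarrow> bool" where
  "wp p s Q \<longleftrightarrow> (\<exists>t s'. ((p, s) \<Rightarrow>[t] s') \<and> Q t s')"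

lemma wp_mono: "wp p s P \<Longrightarrow> (\<And>t s'. P t s' \<Longrightarrow> Q t s') \<Longrightarrow> wp p s Q"
  unfolding wp_def by blast

lemma exec_iffs:
  "((SKIP, s) \<Rightarrow>[t] s') \<longleftrightarrow> t = 1 \<and> s' = s"
  "((x ::= e, s) \<Rightarrow>[t] s') \<longleftrightarrow> t = 1 + cost e \<and> s' = upd_var x (val s e) s"
  "((q \<langle>es\<rangle> ::= e, s) \<Rightarrow>[t] s') \<longleftrightarrow>
     t = 1 + sum_list (map cost es) + cost e \<and> s' = upd_arr q (map (val s) es) (val s e) s"
  "((p1;; p2, s) \<Rightarrow>[t] s') \<longleftrightarrow>
     (\<exists>t1 s1 t2. ((p1, s) \<Rightarrow>[t1] s1) \<and> ((p2, s1) \<Rightarrow>[t2] s') \<and> t = 1 + t1 + t2)"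
  "((IF b THEN p1 ELSE p2, s) \<Rightarrow>[t] s') \<longleftrightarrow>
     (\<exists>u. ((if bval s b then p1 else p2, s) \<Rightarrow>[u] s') \<and> t = 1 + bcost b + u)"
  by (subst exec.simps; auto)+

lemma exec_While_iff: "((WHILE b DO p, s) \<Rightarrow>[t] s') \<longleftrightarrow>
  (if bval s b
   then \<exists>t1 s1 t2. ((p, s) \<Rightarrow>[t1] s1) \<and> ((WHILE b DO p, s1) \<Rightarrow>[t2] s') \<and> t = 1 + bcost b + t1 + t2
   else t = 1 + bcost b \<and> s' = s)"
  by (subst exec.simps) auto

lemma wp_simps:
  "wp SKIP s Q = Q 1 s"
  "wp (x ::= e) s Q = Q (1 + cost e) (upd_var x (val s e) s)"
  "wp (q \<langle>es\<rangle> ::= e) s Q =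
     Q (1 + sum_list (map cost es) + cost e) (upd_arr q (map (val s) es) (val s e) s)"
  "wp (p1;; p2) s Q = wp p1 s (\<lambda>t s'. wp p2 s' (\<lambda>u. Q (1 + t + u)))"
  "wp (IF b THEN p1 ELSE p2) s Q =
     (if bval s b then wp p1 s (\<lambda>t. Q (1 + bcost b + t)) else wp p2 s (\<lambda>t. Q (1 + bcost b + t)))"
  unfolding wp_def exec_iffs by (simp, simp, simp, blast, auto)

text \<open>Both groupings contain two sequencing nodes and cost the same. As \<open>;;\<close>
  associates to the left, this is what allows the first of three commands to be split off.\<close>

lemma wp_Seq_assoc: "wp (p1;; p2;; p3) s Q = wp (p1;; (p2;; p3)) s Q"
  by (simp add: wp_simps add.assoc)

lemma wp_While_unfold: "wp (WHILE b DO p) s Q =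
    (if bval s b then wp p s (\<lambda>t s'. wp (WHILE b DO p) s' (\<lambda>u. Q (1 + bcost b + t + u)))
     else Q (1 + bcost b) s)"
proof (cases "bval s b")
  case True
  then show ?thesis unfolding wp_def exec_While_iff[of b p s] by simp blast
next
  case False
  then show ?thesis unfolding wp_def exec_While_iff[of b p s] by simp
qed

text \<open>The potential method: \<open>\<Phi>\<close> pays for the body and the test of each
  iteration. A test costs at least one step, so \<open>\<Phi>\<close> strictly decreases and serves
  as termination measure too; only the final test remains to be paid.\<close>

lemma wp_While:
  fixes \<Phi> :: "('v, 'r) store \<Rightarrow> nat"
  assumes "Inv s"
    and body: "\<And>s. Inv s \<Longrightarrow> bval s b \<Longrightarrow>
      wp p s (\<lambda>t s'. Inv s' \<and> 1 + bcost b + t + \<Phi> s' \<le> \<Phi> s)"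
  shows "wp (WHILE b DO p) s (\<lambda>t s'. Inv s' \<and> \<not> bval s' b \<and> t + \<Phi> s' \<le> 1 + bcost b + \<Phi> s)"
  using assms(1)
proof (induction "\<Phi> s" arbitrary: s rule: less_induct)
  case less
  show ?case
  proof (cases "bval s b")
    case True
    have "wp p s (\<lambda>t s'. Inv s' \<and> 1 + bcost b + t + \<Phi> s' \<le> \<Phi> s)"
      using body less.prems True by blast
    then show ?thesis
      unfolding wp_While_unfold[of b p s] if_P[OF True]
      by (rule wp_mono) (auto intro!: wp_mono[OF less.hyps])
  next
    case False
    then show ?thesis using less.prems unfolding wp_While_unfold[of b p s] by simp
  qed
qed

lemma vars_upd_var: "vars (upd_var x n s) y = (if y = x then n else vars s y)"
  and arrs_upd_var: "arrs (upd_var x n s) = arrs s"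
  and vars_upd_arr: "vars (upd_arr q is n s) = vars s"
  and arrs_upd_arr: "arrs (upd_arr q is n s) q' js =
      (if q' = q \<and> js = is then n else arrs s q' js)"
  by (auto simp: upd_var_def upd_arr_def)

lemmas store_simps = vars_upd_var arrs_upd_var vars_upd_arr arrs_upd_arr

definition same_except :: "'v set \<Rightarrow> 'r set \<Rightarrow> ('v, 'r) store \<Rightarrow> ('v, 'r) store \<Rightarrow> bool" where
  "same_except V R s s' \<longleftrightarrow>
     (\<forall>v. v \<notin> V \<longrightarrow> vars s' v = vars s v) \<and> (\<forall>q. q \<notin> R \<longrightarrow> arrs s' q = arrs s q)"

lemma same_except_refl: "same_except V R s s"
  by (simp add: same_except_def)

lemma same_except_upd_var: "x \<in> V \<Longrightarrow> same_except V R s (upd_var x n s') = same_except V R s s'"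
  unfolding same_except_def store_simps by auto

lemma same_except_upd_arr: "q \<in> R \<Longrightarrow> same_except V R s (upd_arr q is n s') = same_except V R s s'"
  unfolding same_except_def by (auto simp: upd_arr_def)

section \<open>Representing instance and matching in the store\<close>

lemma input_store_same:
  "input_store I \<sigma> s \<Longrightarrow> same_except V R s s' \<Longrightarrow> NApp \<notin> V \<Longrightarrow> PolLen \<notin> V \<Longrightarrow>
    R \<inter> {CapA, CapC, Pol, PrefLen, Pref, ImmLen, Imm} = {} \<Longrightarrow> input_store I \<sigma> s'"
  unfolding same_except_def input_store_def by auto

lemma input_storeD:
  assumes "input_store I \<sigma> s"
  shows "vars s NApp = napp I" "vars s PolLen = length \<sigma>"
    "k < length \<sigma> \<Longrightarrow> arrs s Pol [k] = \<sigma> ! k"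
    "c < ncrs I \<Longrightarrow> arrs s CapC [c] = capC I c"
    "a < napp I \<Longrightarrow> arrs s CapA [a] = capA I a"
    "a < napp I \<Longrightarrow> arrs s PrefLen [a] = length (pref I a)"
    "a < napp I \<Longrightarrow> k < length (pref I a) \<Longrightarrow> arrs s Pref [a, k] = pref I a ! k"
    "a < napp I \<Longrightarrow> c < ncrs I \<Longrightarrow> arrs s ImmLen [a, c] = card (immediate I a c)"
    "a < napp I \<Longrightarrow> c < ncrs I \<Longrightarrow>
      bij_betw (\<lambda>k. arrs s Imm [a, c, k]) {..<card (immediate I a c)} (immediate I a c)"
  using assms by (simp_all add: input_store_def)

definition marked :: "capr \<Rightarrow> nat set \<Rightarrow> (var, arr) store \<Rightarrow> bool" where
  "marked I X s \<longleftrightarrow> (\<forall>a<napp I. \<forall>c\<in>set (pref I a). arrs s Mark [c] = of_bool (c \<in> X))"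

text \<open>The bijection fixes no order of the courses but forces \<open>BundleLen\<close> to be
  the size of the bundle, which the capacity test of the program relies on.\<close>

definition represents ::
    "capr \<Rightarrow> nat list \<Rightarrow> (nat \<Rightarrow> nat list) \<Rightarrow> (nat \<times> nat) set \<Rightarrow> (var, arr) store \<Rightarrow> bool" where
  "represents I \<sigma> r M s \<longleftrightarrow> input_store I \<sigma> s \<and>
     (\<forall>a<napp I.
        arrs s Ptr [a] \<le> length (pref I a) \<and> r a = drop (arrs s Ptr [a]) (pref I a) \<and>
        bij_betw (\<lambda>k. arrs s Bundle [a, k]) {..<arrs s BundleLen [a]} (bundle_of M a) \<and>
        (\<forall>c\<in>set (pref I a). arrs s InBundle [a, c] = of_bool ((a, c) \<in> M) \<and>
           arrs s Occ [c] = card (assigned_to M c)))"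

lemma representsD:
  assumes "represents I \<sigma> r M s"
  shows "input_store I \<sigma> s"
    "a < napp I \<Longrightarrow> arrs s Ptr [a] \<le> length (pref I a)"
    "a < napp I \<Longrightarrow> r a = drop (arrs s Ptr [a]) (pref I a)"
    "a < napp I \<Longrightarrow> bij_betw (\<lambda>k. arrs s Bundle [a, k]) {..<arrs s BundleLen [a]} (bundle_of M a)"
    "a < napp I \<Longrightarrow> c \<in> set (pref I a) \<Longrightarrow> arrs s InBundle [a, c] = of_bool ((a, c) \<in> M)"
    "a < napp I \<Longrightarrow> c \<in> set (pref I a) \<Longrightarrow> arrs s Occ [c] = card (assigned_to M c)"
  using assms by (simp_all add: represents_def)

lemma represents_same:
  assumes "represents I \<sigma> r M s" "same_except V R s s'" "V \<inter> {NApp, PolLen} = {}" "R \<subseteq> {Queue, Mark}"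
  shows "represents I \<sigma> r M s'"
proof -
  have "input_store I \<sigma> s'"
    using input_store_same[OF representsD(1)[OF assms(1)] assms(2)] assms(3,4) by auto
  moreover have "arrs s' x = arrs s x" if "x \<notin> {Queue, Mark}" for x
    using assms(2,4) that by (auto simp: same_except_def)
  ultimately show ?thesis using assms(1) by (simp add: represents_def)
qed

lemma matching_full_iff:
  "represents I \<sigma> r M s \<Longrightarrow> capr_instance I \<Longrightarrow> a < napp I \<Longrightarrow> c \<in> set (pref I a) \<Longrightarrow>
    arrs s Occ [c] = arrs s CapC [c] \<longleftrightarrow> full I M c"
  using input_storeD(4)[OF representsD(1), of I \<sigma> r M s c] capr_instanceD(3)[of I a]
  by (auto simp: representsD(6) full_def)

section \<open>Prerequisite closures via immediate prerequisites\<close>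

lemma immediate_subset_pref:
  assumes "capr_instance I" "a < napp I" "c \<in> set (pref I a)"
  shows "immediate I a c \<subseteq> set (pref I a)"
  using capr_instanceD(7)[OF assms] by (auto simp: immediate_def prereq_closure_def)

lemma immediate_gain:
  assumes "capr_instance I" "a < napp I" "d \<in> gain I M a c" "e \<in> immediate I a d" "e \<notin> bundle_of M a"
  shows "e \<in> gain I M a c"
  using assms transD[OF capr_instanceD(6)[OF assms(1,2)], of c d e]
  by (auto simp: gain_def immediate_def prereq_closure_def)

text \<open>
  Every prerequisite \<open>d\<close> of \<open>c\<close> is reached from \<open>c\<close> along immediate prerequisites; since bundles
  are closed under prerequisites, such a path avoids the bundle whenever \<open>d\<close> does.
\<close>

lemma gain_subset_closed:
  assumes I: "capr_instance I" and a: "a < napp I" and M: "matching I M"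
    and c: "c \<in> Q" and closed: "\<And>d. d \<in> Q \<Longrightarrow> immediate I a d - bundle_of M a \<subseteq> Q"
  shows "gain I M a c \<subseteq> Q"
proof
  let ?R = "prereq I a"
  have "finite ?R" using capr_instanceD(4)[OF I a] by (rule finite_subset) simp
  moreover have "acyclic ?R"
    using capr_instanceD(5,6)[OF I a] by (simp add: acyclic_irrefl)
  ultimately have wf: "wf (?R\<inverse>)"
    by (simp add: finite_acyclic_wf_converse)
  \<comment> \<open>The target \<open>d\<close> stays fixed while the induction moves
    \<open>x\<close> down along its prerequisites towards \<open>d\<close>.\<close>
  have step: "\<forall>x\<in>Q. (x, d) \<in> ?R \<longrightarrow> d \<notin> bundle_of M a \<longrightarrow> d \<in> Q" for d
  proof (intro ballI impI)
    fix x assume "x \<in> Q" "(x, d) \<in> ?R" and d: "d \<notin> bundle_of M a"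
    from wf this(1,2) show "d \<in> Q"
    proof (induction x rule: wf_induct_rule)
      case (less x)
      show ?case
      proof (cases "d \<in> immediate I a x")
        case True
        then show ?thesis using closed[OF less.prems(1)] d by blast
      next
        case False
        let ?E = "{e. (x, e) \<in> ?R \<and> (e, d) \<in> ?R}"
        from False less.prems obtain e0 where "e0 \<in> ?E" by (auto simp: immediate_def)
        moreover have "wf ?R" using \<open>finite ?R\<close> \<open>acyclic ?R\<close> by (rule finite_acyclic_wf)
        \<comment> \<open>Among the courses strictly between \<open>x\<close> and \<open>d\<close>,
          one nearest to \<open>x\<close> is chosen; by transitivity it is an immediate prerequisite
          of \<open>x\<close>.\<close>
        ultimately obtain e where e: "e \<in> ?E" "\<And>y. (y, e) \<in> ?R \<Longrightarrow> y \<notin> ?E"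
          by (meson wfE_min)
        have "e \<in> immediate I a x"
          using e transD[OF capr_instanceD(6)[OF I a]] unfolding immediate_def by blast
        moreover have "e \<notin> bundle_of M a"
          using matchingD(3)[OF M a, of e] e d by (auto simp: prereq_closure_def)
        ultimately have "e \<in> Q" using closed[OF less.prems(1)] by blast
        then show ?thesis using less.IH[of e] e by blast
      qed
    qed
  qed
  fix d assume "d \<in> gain I M a c"
  then show "d \<in> Q" using c step[of d] by (auto simp: gain_def prereq_closure_def)
qed

section \<open>Invariants of the search\<close>

abbreviation queue :: "(var, arr) store \<Rightarrow> nat \<Rightarrow> nat" where
  "queue s k \<equiv> arrs s Queue [k]"

text \<open>Common to both loops of the search. On acceptable courses the marks coincide with the
  queue contents, so the test on \<open>Mark\<close> is a test for freshness; containment in the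
  gain bounds the queue.\<close>

definition queued :: "capr \<Rightarrow> (nat \<times> nat) set \<Rightarrow> nat \<Rightarrow> nat \<Rightarrow> (var, arr) store \<Rightarrow> (var, arr) store \<Rightarrow> bool" where
  "queued I M a c s0 s \<longleftrightarrow>
     same_except {Size, Ok, Head, Cur, J, Nxt} {Queue, Mark} s0 s \<and>
     inj_on (queue s) {..<vars s Size} \<and> c \<in> queue s ` {..<vars s Size} \<and>
     queue s ` {..<vars s Size} \<subseteq> gain I M a c \<and> marked I (queue s ` {..<vars s Size}) s"

text \<open>\<open>Ok\<close> and the closure condition concern the entries before
  \<open>Head\<close>; when \<open>Head\<close> reaches \<open>Size\<close> they become statements
  about the whole queue.\<close>

definition scanning :: "capr \<Rightarrow> (nat \<times> nat) set \<Rightarrow> nat \<Rightarrow> nat \<Rightarrow> (var, arr) store \<Rightarrow> (var, arr) store \<Rightarrow> bool" where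
  "scanning I M a c s0 s \<longleftrightarrow> queued I M a c s0 s \<and> vars s Head \<le> vars s Size \<and>
     vars s Ok = of_bool (\<forall>k<vars s Head. \<not> full I M (queue s k)) \<and>
     (\<forall>k<vars s Head. immediate I a (queue s k) - bundle_of M a \<subseteq> queue s ` {..<vars s Size})"

text \<open>\<open>s1\<close> is the store on entry to the inner loop. It pins down the queue
  entries present at that moment, since the entry being expanded must stay in place while others are
  appended.\<close>

definition expanding :: "capr \<Rightarrow> (nat \<times> nat) set \<Rightarrow> nat \<Rightarrow> nat \<Rightarrow> (var, arr) store \<Rightarrow> (var, arr) store \<Rightarrow>
    (var, arr) store \<Rightarrow> bool" where
  "expanding I M a c s0 s1 s \<longleftrightarrow> queued I M a c s0 s \<and>
     vars s Head = vars s1 Head \<and> vars s Head < vars s1 Size \<and> vars s1 Size \<le> vars s Size \<and>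
     vars s Ok = vars s1 Ok \<and> (\<forall>k<vars s1 Size. queue s k = queue s1 k) \<and>
     vars s Cur = queue s1 (vars s1 Head) \<and> vars s J \<le> card (immediate I a (vars s Cur)) \<and>
     (\<forall>j<vars s J. arrs s0 Imm [a, vars s Cur, j] \<in> bundle_of M a \<union> queue s ` {..<vars s Size})"

lemma queued_push:
  assumes I: "capr_instance I" and a: "a < napp I" and c: "c \<in> set (pref I a)"
    and q: "queued I M a c s0 s"
    and d: "d \<in> gain I M a c" "d \<notin> queue s ` {..<vars s Size}"
  shows "queued I M a c s0 (upd_var Size (Suc (vars s Size))
    (upd_arr Mark [d] 1 (upd_arr Queue [vars s Size] d s)))"
    (is "queued _ _ _ _ _ ?s")
proof -
  have im: "queue ?s ` {..<vars ?s Size} = insert d (queue s ` {..<vars s Size})"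
    by (auto simp: store_simps lessThan_Suc)
  have "inj_on (queue ?s) {..<vars ?s Size}"
    using q d(2) unfolding queued_def inj_on_def
    by (auto simp: store_simps less_Suc_eq)
  moreover have "marked I (insert d (queue s ` {..<vars s Size})) ?s"
    using q unfolding queued_def marked_def by (auto simp: store_simps)
  ultimately show ?thesis
    using q d(1) unfolding queued_def im
    by (auto simp: same_except_upd_var same_except_upd_arr)
qed

section \<open>Breadth-first search\<close>

lemma queued_upd_var:
  "x \<in> {Ok, Head, Cur, J, Nxt} \<Longrightarrow> queued I M a c s0 (upd_var x n s) = queued I M a c s0 s"
  unfolding queued_def marked_def by (auto simp: store_simps same_except_upd_var)

lemma queued_frame:
  assumes "queued I M a c s0 s"
  shows "vars s App = vars s0 App" "x \<notin> {Queue, Mark} \<Longrightarrow> arrs s x = arrs s0 x"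
  using assms by (auto simp: queued_def same_except_def)

abbreviation expand_prog :: "(var, arr) com" where
  "expand_prog \<equiv>
         Nxt ::= Rd Imm [Var App, Var Cur, Var J];;
         (IF And (Eq (Rd Mark [Var Nxt]) (Lit 0)) (Eq (Rd InBundle [Var App, Var Nxt]) (Lit 0))
          THEN
            Queue \<langle>[Var Size]\<rangle> ::= Var Nxt;;
            Mark \<langle>[Var Nxt]\<rangle> ::= Lit 1;;
            incr Size
          ELSE SKIP);;
         incr J"

abbreviation scan_prog :: "(var, arr) com" where
  "scan_prog \<equiv>
       Cur ::= Rd Queue [Var Head];;
       (IF Eq (Rd Occ [Var Cur]) (Rd CapC [Var Cur]) THEN Ok ::= Lit 0 ELSE SKIP);;
       J ::= Lit 0;;
       WHILE Less (Var J) (Rd ImmLen [Var App, Var Cur]) DO (expand_prog);;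
       incr Head"

lemma expand_step:
  assumes I: "capr_instance I" and a: "a < napp I" and c: "c \<in> set (pref I a)"
    and rep: "represents I \<sigma> r M s0" and App: "vars s0 App = a"
    and E: "expanding I M a c s0 s1 s" and guard: "vars s J < card (immediate I a (vars s Cur))"
  shows "wp (expand_prog) s (\<lambda>t s'. expanding I M a c s0 s1 s' \<and> vars s' J = Suc (vars s J) \<and>
           vars s' Cur = vars s Cur \<and> t \<le> 50)"
proof -
  define d where "d = vars s Cur"
  define n where "n = arrs s0 Imm [a, d, vars s J]"
  have q: "queued I M a c s0 s" using E by (simp add: expanding_def)
  have frame: "vars s App = a" "arrs s Imm = arrs s0 Imm" "arrs s InBundle = arrs s0 InBundle"
    using queued_frame[OF q] App by simp_all
  have dq: "d = queue s (vars s Head)" "vars s Head < vars s Size"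
    using E by (auto simp: expanding_def d_def)
  then have dg: "d \<in> gain I M a c" using q by (auto simp: queued_def)
  then have dp: "d \<in> set (pref I a)" using gain_subset_pref[OF I a c] by blast
  then have "d < ncrs I" using capr_instanceD(3)[OF I a] by blast
  then have n_imm: "n \<in> immediate I a d"
    using input_storeD(9)[OF representsD(1)[OF rep] a] guard unfolding n_def d_def
    by (blast dest: bij_betwE)
  then have np: "n \<in> set (pref I a)" using immediate_subset_pref[OF I a dp] by blast
  have mark: "arrs s Mark [n] = of_bool (n \<in> queue s ` {..<vars s Size})"
    using q np a by (simp add: queued_def marked_def)
  have inb: "arrs s0 InBundle [a, n] = of_bool ((a, n) \<in> M)"
    using representsD(5)[OF rep a np] .
  show ?thesis
  proof (cases "n \<in> queue s ` {..<vars s Size} \<or> (a, n) \<in> M")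
    case True
    let ?s = "upd_var J (Suc (vars s J)) (upd_var Nxt n s)"
    have "expanding I M a c s0 s1 ?s"
      using E True guard unfolding expanding_def
      by (auto simp: queued_upd_var store_simps less_Suc_eq n_def d_def)
    then show ?thesis
      using True by (auto simp: wp_simps store_simps frame mark inb n_def[symmetric] d_def[symmetric])
  next
    case False
    let ?s = "upd_var J (Suc (vars s J)) (upd_var Size (Suc (vars s Size))
      (upd_arr Mark [n] 1 (upd_arr Queue [vars s Size] n (upd_var Nxt n s))))"
    have "n \<in> gain I M a c" using immediate_gain[OF I a dg n_imm] False by simp
    then have q': "queued I M a c s0 ?s"
      using queued_push[OF I a c, of M s0 "upd_var Nxt n s" n] q False
      by (simp add: queued_upd_var store_simps)
    have im: "queue ?s ` {..<vars ?s Size} = insert n (queue s ` {..<vars s Size})"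
      by (auto simp: store_simps lessThan_Suc)
    have "expanding I M a c s0 s1 ?s"
      using E guard q' unfolding expanding_def im
      by (auto simp: store_simps less_Suc_eq n_def d_def)
    then show ?thesis
      using False by (simp add: wp_simps store_simps frame mark inb n_def[symmetric] d_def[symmetric])
  qed
qed

lemma expand_loop:
  assumes I: "capr_instance I" and a: "a < napp I" and c: "c \<in> set (pref I a)"
    and rep: "represents I \<sigma> r M s0" and App: "vars s0 App = a"
    and E: "expanding I M a c s0 s1 s" and J: "vars s J = 0"
  shows "wp (WHILE Less (Var J) (Rd ImmLen [Var App, Var Cur]) DO (expand_prog)) s (\<lambda>t s'. expanding I M a c s0 s1 s' \<and>
           immediate I a (vars s' Cur) - bundle_of M a \<subseteq> queue s' ` {..<vars s' Size} \<and>
           t \<le> 10 + 60 * card (immediate I a (vars s' Cur)))"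
    (is "wp (WHILE ?b DO ?p) _ _")
proof -
  let ?d = "queue s1 (vars s1 Head)"
  \<comment> \<open>The 60 per index covers the at most 50 steps of \<open>expand_step\<close> and
    the loop test.\<close>
  let ?\<Phi> = "\<lambda>s. 60 * (card (immediate I a ?d) - vars s J)"
  have imm_len: "val s (Rd ImmLen [Var App, Var Cur]) = card (immediate I a (vars s Cur))" "vars s Cur = ?d"
      "bij_betw (\<lambda>j. arrs s0 Imm [a, ?d, j]) {..<card (immediate I a ?d)} (immediate I a ?d)"
    if E: "expanding I M a c s0 s1 s" for s
  proof -
    have q: "queued I M a c s0 s" using E by (simp add: expanding_def)
    have "vars s Cur = queue s (vars s Head)" "vars s Head < vars s Size"
      using E by (auto simp: expanding_def)
    then have "vars s Cur \<in> gain I M a c" using q by (auto simp: queued_def)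
    then have "vars s Cur < ncrs I"
      using gain_subset_pref[OF I a c] capr_instanceD(3)[OF I a] by blast
    then show "val s (Rd ImmLen [Var App, Var Cur]) = card (immediate I a (vars s Cur))" "vars s Cur = ?d"
      "bij_betw (\<lambda>j. arrs s0 Imm [a, ?d, j]) {..<card (immediate I a ?d)} (immediate I a ?d)"
      using input_storeD(8,9)[OF representsD(1)[OF rep] a] queued_frame[OF q] App E
      by (auto simp: expanding_def)
  qed
  have "wp (WHILE ?b DO ?p) s (\<lambda>t s'. expanding I M a c s0 s1 s' \<and> \<not> bval s' ?b \<and>
      t + ?\<Phi> s' \<le> 1 + bcost ?b + ?\<Phi> s)"
  proof (rule wp_While, rule E)
    fix s assume E: "expanding I M a c s0 s1 s" and b: "bval s ?b"
    then have "vars s J < card (immediate I a (vars s Cur))"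
      using imm_len(1)[OF E] by simp
    with expand_step[OF I a c rep App E]
    show "wp ?p s (\<lambda>t s'. expanding I M a c s0 s1 s' \<and> 1 + bcost ?b + t + ?\<Phi> s' \<le> ?\<Phi> s)"
      using imm_len(2)[OF E] by (auto elim!: wp_mono)
  qed
  then show ?thesis
  proof (rule wp_mono, elim conjE, intro conjI)
    fix t s' assume E': "expanding I M a c s0 s1 s'" and nb: "\<not> bval s' ?b"
      and t: "t + ?\<Phi> s' \<le> 1 + bcost ?b + ?\<Phi> s"
    show "expanding I M a c s0 s1 s'" by fact
    have J': "vars s' J = card (immediate I a ?d)"
      using nb E' imm_len(1)[OF E'] imm_len(2)[OF E'] by (auto simp: expanding_def)
    show "t \<le> 10 + 60 * card (immediate I a (vars s' Cur))"
      using t J imm_len(2)[OF E'] by simp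
    \<comment> \<open>\<open>Imm\<close> enumerates all immediate prerequisites, so after the last
      index none is left outside both the bundle and the queue.\<close>
    have "immediate I a ?d = (\<lambda>j. arrs s0 Imm [a, ?d, j]) ` {..<card (immediate I a ?d)}"
      using imm_len(3)[OF E'] by (simp add: bij_betw_def)
    moreover have "(\<lambda>j. arrs s0 Imm [a, ?d, j]) ` {..<card (immediate I a ?d)} \<subseteq>
        bundle_of M a \<union> queue s' ` {..<vars s' Size}"
      using E' J' imm_len(2)[OF E'] unfolding expanding_def by auto
    ultimately show "immediate I a (vars s' Cur) - bundle_of M a \<subseteq> queue s' ` {..<vars s' Size}"
      using imm_len(2)[OF E'] by (simp only:) blast
  qed
qed

text \<open>The queue only grows and keeps its old entries, so the closure condition for earlier
  entries survives, and the inner loop supplies it for the entry at \<open>Head\<close>.\<close>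

lemma scanning_advance:
  assumes S: "scanning I M a c s0 s" and E: "expanding I M a c s0 s1 s'"
    and s1: "arrs s1 Queue = arrs s Queue" "vars s1 Size = vars s Size" "vars s1 Head = vars s Head"
      "vars s1 Ok = of_bool (\<forall>k<Suc (vars s Head). \<not> full I M (queue s k))"
    and imm: "immediate I a (vars s' Cur) - bundle_of M a \<subseteq> queue s' ` {..<vars s' Size}"
  shows "scanning I M a c s0 (upd_var Head (Suc (vars s Head)) s')"
proof -
  have q: "queued I M a c s0 s'" and h: "vars s Head < vars s Size" "vars s Size \<le> vars s' Size"
    and old: "\<And>k. k < vars s Size \<Longrightarrow> queue s' k = queue s k"
    and Ok: "vars s' Ok = vars s1 Ok" and Cur: "vars s' Cur = queue s (vars s Head)"
    using E s1 by (auto simp: expanding_def)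
  have "queue s ` {..<vars s Size} = queue s' ` {..<vars s Size}"
    using old by (intro image_cong) simp_all
  also have "\<dots> \<subseteq> queue s' ` {..<vars s' Size}"
    using h(2) by (intro image_mono) simp
  finally have sub: "queue s ` {..<vars s Size} \<subseteq> queue s' ` {..<vars s' Size}" .
  have "immediate I a (queue s k) - bundle_of M a \<subseteq> queue s' ` {..<vars s' Size}"
    if "k < Suc (vars s Head)" for k
  proof (cases "k = vars s Head")
    case True
    then show ?thesis using imm Cur by simp
  next
    case False
    then have "k < vars s Head" using that by simp
    then have "immediate I a (queue s k) - bundle_of M a \<subseteq> queue s ` {..<vars s Size}"
      using S by (simp add: scanning_def)
    then show ?thesis using sub by (rule subset_trans)
  qed
  moreover have "(\<forall>k<Suc (vars s Head). \<not> full I M (queue s' k)) \<longleftrightarrow>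
      (\<forall>k<Suc (vars s Head). \<not> full I M (queue s k))"
    using old h(1) by simp
  ultimately show ?thesis
    using q h old Ok s1(4) unfolding scanning_def by (simp add: queued_upd_var store_simps)
qed

lemma scan_step:
  assumes I: "capr_instance I" and a: "a < napp I" and c: "c \<in> set (pref I a)"
    and rep: "represents I \<sigma> r M s0" and App: "vars s0 App = a"
    and S: "scanning I M a c s0 s" and guard: "vars s Head < vars s Size"
  shows "wp (scan_prog) s (\<lambda>t s'. scanning I M a c s0 s' \<and> vars s' Head = Suc (vars s Head) \<and>
         (\<forall>k\<le>vars s Head. queue s' k = queue s k) \<and>
         t \<le> 50 + 60 * card (immediate I a (queue s (vars s Head))))"
    (is "wp (_;; ?W;; _) _ _")
proof -
  define h where "h = vars s Head"
  define d where "d = queue s h"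
  \<comment> \<open>A single store describes both branches of the fullness test, so the inner loop
    is treated once.\<close>
  define s1 where "s1 = upd_var J 0 ((if full I M d then upd_var Ok 0 else id) (upd_var Cur d s))"
  have q: "queued I M a c s0 s" using S by (simp add: scanning_def)
  then have "d \<in> gain I M a c" using guard by (auto simp: queued_def d_def h_def)
  then have dp: "d \<in> set (pref I a)" using gain_subset_pref[OF I a c] by blast
  have full: "arrs s Occ [d] = arrs s CapC [d] \<longleftrightarrow> full I M d"
    using matching_full_iff[OF rep I a dp] queued_frame[OF q] by simp
  have s1: "arrs s1 Queue = arrs s Queue" "vars s1 Size = vars s Size" "vars s1 Head = vars s Head"
      "vars s1 Ok = of_bool (\<forall>k<Suc (vars s Head). \<not> full I M (queue s k))"
      "vars s1 Cur = d" "vars s1 J = 0"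
    using S by (auto simp: s1_def store_simps scanning_def less_Suc_eq d_def h_def)
  have "queued I M a c s0 s1"
    using q by (simp add: s1_def queued_upd_var)
  then have E: "expanding I M a c s0 s1 s1"
    using s1 guard unfolding expanding_def by (simp add: d_def h_def)
  have post: "scanning I M a c s0 (upd_var Head (Suc (vars s' Head)) s') \<and>
      vars s' Head = h \<and> (\<forall>k\<le>h. queue s' k = queue s k) \<and> vars s' Cur = d"
    if "expanding I M a c s0 s1 s'"
      "immediate I a (vars s' Cur) - bundle_of M a \<subseteq> queue s' ` {..<vars s' Size}" for s'
    using scanning_advance[OF S that(1) s1(1-4) that(2)] that(1) s1 guard
    by (auto simp: expanding_def h_def d_def)
  have "wp ?W s1 (\<lambda>t s'. (scanning I M a c s0 (upd_var Head (Suc (vars s' Head)) s') \<and>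
      vars s' Head = h \<and> (\<forall>k\<le>h. queue s' k = queue s k)) \<and> t \<le> 10 + 60 * card (immediate I a d))"
    by (rule wp_mono[OF expand_loop[OF I a c rep App E s1(6)]]) (use post in fastforce)
  then show ?thesis
    by (cases "full I M d")
      (simp_all add: wp_simps store_simps full s1_def d_def[symmetric] h_def[symmetric],
        (erule wp_mono, auto simp: store_simps)+)
qed

lemma collect_wp:
  assumes I: "capr_instance I" and a: "a < napp I" and c: "c \<in> set (pref I a)"
    and M: "matching I M" and nc: "c \<notin> bundle_of M a"
    and rep: "represents I \<sigma> r M s" and App: "vars s App = a" and Crs: "vars s Crs = c"
    and mark: "marked I {} s"
  shows "wp collect_prog s (\<lambda>t s'. same_except {Size, Ok, Head, Cur, J, Nxt} {Queue, Mark} s s' \<and>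
      bij_betw (queue s') {..<vars s' Size} (gain I M a c) \<and> marked I (gain I M a c) s' \<and>
      vars s' Ok = of_bool (\<forall>d\<in>gain I M a c. \<not> full I M d) \<and>
      t \<le> 100 + (\<Sum>d\<in>gain I M a c. 60 + 60 * card (immediate I a d)))"
proof -
  let ?G = "gain I M a c" and ?f = "\<lambda>d. 60 + 60 * card (immediate I a d)"
  \<comment> \<open>The potential is the cost of the courses of the gain not scanned yet. As the
    queue has no repetitions and stays inside the gain, each iteration removes exactly one
    summand.\<close>
  let ?\<Phi> = "\<lambda>s. \<Sum>d\<in>?G - queue s ` {..<vars s Head}. ?f d"
  let ?s = "upd_var Head 0 (upd_var Ok 1 (upd_var Size 1 (upd_arr Mark [c] 1 (upd_arr Queue [0] c s))))"
  have finG: "finite ?G" using gain_subset_pref[OF I a c] by (rule finite_subset) simp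
  have "queued I M a c s ?s"
    using mark self_in_gain[OF nc] unfolding queued_def marked_def
    by (auto simp: same_except_upd_var same_except_upd_arr same_except_refl store_simps lessThan_Suc)
  then have S: "scanning I M a c s ?s" by (simp add: scanning_def store_simps)
  note step = scan_step[OF I a c rep App]
  have loop: "wp (WHILE Less (Var Head) (Var Size) DO (scan_prog)) ?s (\<lambda>t s'. scanning I M a c s s' \<and> \<not> bval s' (Less (Var Head) (Var Size)) \<and>
         t + ?\<Phi> s' \<le> 1 + bcost (Less (Var Head) (Var Size) :: (var, arr) bexp) + ?\<Phi> ?s)"
    (is "wp (WHILE ?b DO ?p) _ _")
  proof (rule wp_While, rule S)
    fix s1 assume S1: "scanning I M a c s s1" and "bval s1 ?b"
    then have b: "vars s1 Head < vars s1 Size" by simp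
    let ?h = "vars s1 Head"
    show "wp ?p s1 (\<lambda>t s'. scanning I M a c s s' \<and> 1 + bcost ?b + t + ?\<Phi> s' \<le> ?\<Phi> s1)"
    proof (rule wp_mono[OF step[OF S1 b]], elim conjE, intro conjI)
      fix t s2
      assume s2: "vars s2 Head = Suc ?h" "\<forall>k\<le>?h. queue s2 k = queue s1 k"
        and t: "t \<le> 50 + 60 * card (immediate I a (queue s1 ?h))"
      have inj: "inj_on (queue s1) {..<vars s1 Size}" and G: "queue s1 ` {..<vars s1 Size} \<subseteq> ?G"
        using S1 by (auto simp: scanning_def queued_def)
      have new: "queue s1 ?h \<in> ?G - queue s1 ` {..<?h}"
        using inj G b by (auto dest: inj_onD)
      have "queue s2 ` {..<Suc ?h} = insert (queue s1 ?h) (queue s1 ` {..<?h})"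
        using s2(2) by (auto simp: lessThan_Suc)
      then have "?G - queue s1 ` {..<?h} = insert (queue s1 ?h) (?G - queue s2 ` {..<vars s2 Head})"
        using new s2(1) by auto
      moreover have "queue s1 ?h \<notin> ?G - queue s2 ` {..<vars s2 Head}"
        using s2 by auto
      ultimately have "?\<Phi> s1 = ?f (queue s1 ?h) + ?\<Phi> s2"
        using finG by simp
      then show "1 + bcost ?b + t + ?\<Phi> s2 \<le> ?\<Phi> s1" using t by simp
    qed
  qed
  have post: "same_except {Size, Ok, Head, Cur, J, Nxt} {Queue, Mark} s s' \<and>
      bij_betw (queue s') {..<vars s' Size} ?G \<and> marked I ?G s' \<and>
      vars s' Ok = of_bool (\<forall>d\<in>?G. \<not> full I M d)"
    if S': "scanning I M a c s s'" and "\<not> vars s' Head < vars s' Size" for s'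
  proof -
    have h: "vars s' Head = vars s' Size" and q: "queued I M a c s s'"
      using that by (auto simp: scanning_def)
    let ?Q = "queue s' ` {..<vars s' Size}"
    \<comment> \<open>Completeness of the search: with \<open>Head\<close> at \<open>Size\<close>
      all entries are expanded, so the queue is closed under immediate prerequisites outside the
      bundle.\<close>
    have "?G \<subseteq> ?Q"
      using q S' by (intro gain_subset_closed[OF I a M]) (auto simp: queued_def scanning_def h)
    then have Q: "?Q = ?G" using q by (auto simp: queued_def)
    moreover have "vars s' Ok = of_bool (\<forall>d\<in>?G. \<not> full I M d)"
      using S' h unfolding Q[symmetric] by (auto simp: scanning_def)
    ultimately show ?thesis
      using q by (simp add: queued_def bij_betw_def)
  qed
  have "wp (WHILE ?b DO ?p) ?s (\<lambda>t s'. (same_except {Size, Ok, Head, Cur, J, Nxt} {Queue, Mark} s s' \<and>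
      bij_betw (queue s') {..<vars s' Size} ?G \<and> marked I ?G s' \<and>
      vars s' Ok = of_bool (\<forall>d\<in>?G. \<not> full I M d)) \<and> t \<le> 10 + sum ?f ?G)"
  proof (rule wp_mono[OF loop], intro conjI)
    fix t s' assume A: "scanning I M a c s s' \<and> \<not> bval s' ?b \<and> t + ?\<Phi> s' \<le> 1 + bcost ?b + ?\<Phi> ?s"
    then show "same_except {Size, Ok, Head, Cur, J, Nxt} {Queue, Mark} s s'"
      "bij_betw (queue s') {..<vars s' Size} ?G" "marked I ?G s'"
      "vars s' Ok = of_bool (\<forall>d\<in>?G. \<not> full I M d)"
      using post[of s'] by simp_all
    show "t \<le> 10 + sum ?f ?G" using A by (simp add: store_simps)
  qed
  then show ?thesis
    unfolding collect_prog_def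
    by (simp add: wp_simps store_simps Crs split del: split_of_bool) (erule wp_mono, simp)
qed

section \<open>Updating the bundles\<close>

lemma unmark_wp:
  assumes X: "queue s ` {..<vars s Size} = X" and mark: "marked I X s"
  shows "wp unmark_prog s (\<lambda>t s'. same_except {Head} {Mark} s s' \<and> marked I {} s' \<and>
    t \<le> 20 + 20 * vars s Size)"
proof -
  let ?Inv = "\<lambda>s'. same_except {Head} {Mark} s s' \<and> vars s' Head \<le> vars s Size \<and>
    marked I (X - queue s ` {..<vars s' Head}) s'"
  let ?\<Phi> = "\<lambda>s'. 20 * (vars s Size - vars s' Head)"
  let ?s = "upd_var Head 0 s"
  have "wp (WHILE Less (Var Head) (Var Size) DO (Mark \<langle>[Rd Queue [Var Head]]\<rangle> ::= Lit 0;; incr Head))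
      ?s (\<lambda>t s'. ?Inv s' \<and> \<not> bval s' (Less (Var Head) (Var Size)) \<and>
        t + ?\<Phi> s' \<le> 1 + bcost (Less (Var Head) (Var Size) :: (var, arr) bexp) + ?\<Phi> ?s)"
    (is "wp (WHILE ?b DO ?p) _ _")
  proof (rule wp_While)
    show "?Inv ?s"
      using mark by (simp add: same_except_upd_var same_except_refl store_simps marked_def)
  next
    fix s1 assume inv: "?Inv s1" and b: "bval s1 ?b"
    let ?h = "vars s1 Head"
    have q: "arrs s1 Queue = arrs s Queue" "vars s1 Size = vars s Size"
      using inv by (auto simp: same_except_def)
    then have h: "?h < vars s Size" using b by simp
    have "marked I (X - queue s ` {..<Suc ?h}) (upd_var Head (Suc ?h) (upd_arr Mark [queue s ?h] 0 s1))"
      using inv by (auto simp: marked_def store_simps lessThan_Suc)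
    then show "wp ?p s1 (\<lambda>t s'. ?Inv s' \<and> 1 + bcost ?b + t + ?\<Phi> s' \<le> ?\<Phi> s1)"
      using inv h by (simp add: wp_simps store_simps q same_except_upd_var same_except_upd_arr)
  qed
  then have "wp (WHILE ?b DO ?p) ?s (\<lambda>t s'. same_except {Head} {Mark} s s' \<and> marked I {} s' \<and>
      t \<le> 10 + 20 * vars s Size)"
  proof (rule wp_mono, elim conjE, intro conjI)
    fix t s' assume 1: "same_except {Head} {Mark} s s'" "vars s' Head \<le> vars s Size"
      "marked I (X - queue s ` {..<vars s' Head}) s'" "\<not> bval s' ?b"
      and t: "t + ?\<Phi> s' \<le> 1 + bcost ?b + ?\<Phi> ?s"
    then have "vars s' Head = vars s Size" by (auto simp: same_except_def)
    then show "marked I {} s'" using 1(3) X by simp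
    show "t \<le> 10 + 20 * vars s Size" using t by (simp add: store_simps)
  qed
  then show ?thesis
    unfolding unmark_prog_def by (simp add: wp_simps store_simps) (erule wp_mono, simp)
qed

text \<open>Courses enter a bundle one at a time, and a course may precede its prerequisites, so the
  sets in between need not be matchings. Hence only finiteness of \<open>M\<close> is assumed, which
  keeps the cardinalities meaningful.\<close>

lemma represents_insert:
  assumes rep: "represents I \<sigma> r M s" and fin: "finite M" and a: "a < napp I"
    and d: "(a, d) \<notin> M"
  shows "represents I \<sigma> r (insert (a, d) M) (upd_arr Occ [d] (Suc (arrs s Occ [d]))
    (upd_arr InBundle [a, d] 1 (upd_arr BundleLen [a] (Suc (arrs s BundleLen [a]))
      (upd_arr Bundle [a, arrs s BundleLen [a]] d s))))"
    (is "represents _ _ _ ?M ?s")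
proof -
  have "same_except {} {Occ, InBundle, BundleLen, Bundle} s ?s"
    by (simp add: same_except_upd_arr same_except_refl)
  then have inp: "input_store I \<sigma> ?s"
    by (rule input_store_same[OF representsD(1)[OF rep]]) auto
  have bundles: "bij_betw (\<lambda>k. arrs ?s Bundle [b, k]) {..<arrs ?s BundleLen [b]} (bundle_of ?M b)"
    if b: "b < napp I" for b
  proof (cases "b = a")
    case True
    let ?n = "arrs s BundleLen [a]"
    have "bij_betw (\<lambda>k. arrs ?s Bundle [a, k]) {..<?n} (bundle_of M a)"
      using representsD(4)[OF rep a] by (rule bij_betw_cong[THEN iffD1, rotated]) (simp add: store_simps)
    moreover have "bij_betw (\<lambda>k. arrs ?s Bundle [a, k]) {?n} {d}"
      by (simp add: bij_betw_def store_simps)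
    ultimately have "bij_betw (\<lambda>k. arrs ?s Bundle [a, k]) ({..<?n} \<union> {?n}) (bundle_of M a \<union> {d})"
      using d by (intro bij_betw_combine) auto
    moreover have "{..<?n} \<union> {?n} = {..<arrs ?s BundleLen [a]}" by (auto simp: store_simps)
    moreover have "bundle_of M a \<union> {d} = bundle_of ?M a" by auto
    ultimately show ?thesis using True by simp
  next
    case False
    moreover from this have "bundle_of ?M b = bundle_of M b" by auto
    ultimately show ?thesis using representsD(4)[OF rep b] by (simp add: store_simps)
  qed
  have "card (assigned_to ?M e) = (if e = d then Suc (card (assigned_to M e)) else card (assigned_to M e))" for e
  proof (cases "e = d")
    case True
    then have "assigned_to ?M e = insert a (assigned_to M e)" by auto
    then show ?thesis using True d fin by (simp add: finite_Image)
  next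
    case False
    then have "assigned_to ?M e = assigned_to M e" by auto
    then show ?thesis using False by simp
  qed
  then show ?thesis
    unfolding represents_def using inp bundles rep
    by (auto simp: store_simps representsD)
qed

lemma represents_upd_var:
  "x \<notin> {NApp, PolLen} \<Longrightarrow> represents I \<sigma> r M s \<Longrightarrow> represents I \<sigma> r M (upd_var x n s)"
  by (rule represents_same[of I \<sigma> r M s "{x}" "{}"]) (auto simp: same_except_upd_var same_except_refl)

lemma add_wp:
  assumes rep: "represents I \<sigma> r M s" and fin: "finite M" and a: "a < napp I" and App: "vars s App = a"
    and X: "bij_betw (queue s) {..<vars s Size} X" and disj: "X \<inter> bundle_of M a = {}"
  shows "wp add_prog s (\<lambda>t s'. same_except {Head, Cur, Done} {Bundle, BundleLen, InBundle, Occ} s s' \<and>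
    represents I \<sigma> r (M \<union> {a} \<times> X) s' \<and> vars s' Done = 1 \<and> t \<le> 30 + 60 * vars s Size)"
proof -
  let ?N = "\<lambda>h. M \<union> {a} \<times> queue s ` {..<h}"
  let ?Inv = "\<lambda>s'. same_except {Head, Cur} {Bundle, BundleLen, InBundle, Occ} s s' \<and>
    vars s' Head \<le> vars s Size \<and> represents I \<sigma> r (?N (vars s' Head)) s'"
  let ?\<Phi> = "\<lambda>s'. 60 * (vars s Size - vars s' Head)"
  let ?s = "upd_var Head 0 s"
  have "wp (WHILE Less (Var Head) (Var Size) DO (
       Cur ::= Rd Queue [Var Head];;
       Bundle \<langle>[Var App, Rd BundleLen [Var App]]\<rangle> ::= Var Cur;;
       incr_at BundleLen [Var App];;
       InBundle \<langle>[Var App, Var Cur]\<rangle> ::= Lit 1;;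
       incr_at Occ [Var Cur];;
       incr Head
     )) ?s (\<lambda>t s'. ?Inv s' \<and> \<not> bval s' (Less (Var Head) (Var Size)) \<and>
        t + ?\<Phi> s' \<le> 1 + bcost (Less (Var Head) (Var Size) :: (var, arr) bexp) + ?\<Phi> ?s)"
    (is "wp (WHILE ?b DO ?p) _ _")
  proof (rule wp_While)
    show "?Inv ?s"
      using represents_upd_var[OF _ rep] by (simp add: same_except_upd_var same_except_refl store_simps)
  next
    fix s1 assume inv: "?Inv s1" and b: "bval s1 ?b"
    let ?h = "vars s1 Head"
    have q: "arrs s1 Queue = arrs s Queue" "vars s1 Size = vars s Size" "vars s1 App = a"
      using inv App by (auto simp: same_except_def)
    then have h: "?h < vars s Size" using b by simp
    let ?d = "queue s ?h"
    \<comment> \<open>Counters may be incremented only for new pairs: injectivity of the queue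
      excludes repetitions, \<open>disj\<close> excludes old courses.\<close>
    have "?d \<notin> queue s ` {..<?h}"
      using X h by (auto simp: bij_betw_def dest: inj_onD)
    moreover have "?d \<notin> bundle_of M a"
      using X h disj by (auto simp: bij_betw_def)
    ultimately have new: "(a, ?d) \<notin> ?N ?h" by auto
    have N: "?N (Suc ?h) = insert (a, ?d) (?N ?h)" by (auto simp: lessThan_Suc)
    have "represents I \<sigma> r (?N ?h) (upd_var Cur ?d s1)"
      using inv represents_upd_var by auto
    then have "represents I \<sigma> r (?N (Suc ?h)) (upd_var Head (Suc ?h) (upd_arr Occ [?d] (Suc (arrs s1 Occ [?d]))
      (upd_arr InBundle [a, ?d] 1 (upd_arr BundleLen [a] (Suc (arrs s1 BundleLen [a]))
      (upd_arr Bundle [a, arrs s1 BundleLen [a]] ?d (upd_var Cur ?d s1))))))"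
      unfolding N using represents_insert[OF _ _ a new, of \<sigma> r "upd_var Cur ?d s1"] fin
      by (intro represents_upd_var) (auto simp: store_simps)
    then show "wp ?p s1 (\<lambda>t s'. ?Inv s' \<and> 1 + bcost ?b + t + ?\<Phi> s' \<le> ?\<Phi> s1)"
      using inv h by (simp add: wp_simps store_simps q same_except_upd_var same_except_upd_arr)
  qed
  then have "wp (WHILE ?b DO ?p) ?s (\<lambda>t s'. same_except {Head, Cur, Done} {Bundle, BundleLen, InBundle, Occ} s s' \<and>
      represents I \<sigma> r (M \<union> {a} \<times> X) (upd_var Done 1 s') \<and> t \<le> 10 + 60 * vars s Size)"
  proof (rule wp_mono, elim conjE, intro conjI)
    fix t s' assume 1: "same_except {Head, Cur} {Bundle, BundleLen, InBundle, Occ} s s'"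
      "vars s' Head \<le> vars s Size" "represents I \<sigma> r (?N (vars s' Head)) s'" "\<not> bval s' ?b"
      and t: "t + ?\<Phi> s' \<le> 1 + bcost ?b + ?\<Phi> ?s"
    then have "vars s' Head = vars s Size" by (auto simp: same_except_def)
    then show "represents I \<sigma> r (M \<union> {a} \<times> X) (upd_var Done 1 s')"
      using 1(3) X represents_upd_var by (simp add: bij_betw_def)
    show "t \<le> 10 + 60 * vars s Size" using t by (simp add: store_simps)
    show "same_except {Head, Cur, Done} {Bundle, BundleLen, InBundle, Occ} s s'"
      using 1(1) by (auto simp: same_except_def)
  qed
  then show ?thesis
    unfolding add_prog_def
    by (simp add: wp_simps store_simps) (erule wp_mono, simp add: same_except_upd_var)
qed

section \<open>Turns and the complete program\<close>

text \<open>Up to a constant factor, the cost of one attempt. The summand \<open>1\<close> pays for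
  attempts that stop at the first test.\<close>

definition work :: "capr \<Rightarrow> nat \<Rightarrow> nat" where
  "work I a = 1 + ncrs I + (\<Sum>c<ncrs I. card (immediate I a c))"

text \<open>The 80 per course consists of 60 for adding and 20 for unmarking it. Together with the
  60 for scanning it this gives the factor 140.\<close>

lemma gain_cost:
  assumes I: "capr_instance I" and a: "a < napp I" and c: "c \<in> set (pref I a)"
  shows "(\<Sum>d\<in>gain I M a c. 60 + 60 * card (immediate I a d)) + 80 * card (gain I M a c) + 60 \<le>
    140 * work I a"
proof -
  have G: "gain I M a c \<subseteq> {..<ncrs I}"
    using gain_subset_pref[OF I a c] capr_instanceD(3)[OF I a] by blast
  then have "(\<Sum>d\<in>gain I M a c. 60 + 60 * card (immediate I a d)) \<le>
      (\<Sum>d<ncrs I. 60 + 60 * card (immediate I a d))"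
    by (intro sum_mono2) auto
  also have "\<dots> = 60 * ncrs I + 60 * (\<Sum>d<ncrs I. card (immediate I a d))"
    by (simp add: sum.distrib sum_distrib_left)
  finally show ?thesis
    using card_mono[OF _ G] by (simp add: work_def)
qed

section \<open>A single attempt and a single turn\<close>

abbreviation attempt_prog :: "(var, arr) com" where
  "attempt_prog \<equiv>
       Crs ::= Rd Pref [Var App, Rd Ptr [Var App]];;
       incr_at Ptr [Var App];;
       IF And (Eq (Rd InBundle [Var App, Var Crs]) (Lit 0)) (Less (Rd Occ [Var Crs]) (Rd CapC [Var Crs]))
       THEN
         collect_prog;;
         (IF And (Eq (Var Ok) (Lit 1))
              (Less (Plus (Rd BundleLen [Var App]) (Var Size)) (Plus (Rd CapA [Var App]) (Lit 1)))
          THEN add_prog ELSE SKIP);;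
         unmark_prog
       ELSE SKIP"

text \<open>The two variables whose values the main loop needs across a turn; the input sizes are
  protected by \<open>represents\<close>.\<close>

definition keeps_control :: "(var, arr) store \<Rightarrow> (var, arr) store \<Rightarrow> bool" where
  "keeps_control s s' \<longleftrightarrow> vars s' App = vars s App \<and> vars s' K = vars s K"

lemma attempt_wp:
  assumes I: "capr_instance I" and a: "a < napp I" and M: "matching I M"
    and rep: "represents I \<sigma> r M s" and App: "vars s App = a" and mark: "marked I {} s"
    and Done: "vars s Done = 0" and ptr: "r a = c # cs"
  shows "wp attempt_prog s (\<lambda>t s'. keeps_control s s' \<and> marked I {} s' \<and>
    represents I \<sigma> (r(a := cs)) (if accepts I M a c then M \<union> {a} \<times> gain I M a c else M) s' \<and>
    vars s' Done = of_bool (accepts I M a c) \<and> t \<le> 500 * work I a)"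
proof -
  define p where "p = arrs s Ptr [a]"
  let ?G = "gain I M a c"
  let ?s = "upd_arr Ptr [a] (Suc p) (upd_var Crs c s)"
  have drop: "drop p (pref I a) = c # cs"
    using representsD(3)[OF rep a] ptr by (simp add: p_def)
  then have p: "p < length (pref I a)" "pref I a ! p = c" "drop (Suc p) (pref I a) = cs"
    by (metis drop_eq_Nil list.distinct(1) not_le, metis hd_drop_conv_nth drop_eq_Nil list.distinct(1) list.sel(1) not_le,
        metis drop_Suc drop_tl list.sel(3))
  then have c: "c \<in> set (pref I a)" by (metis nth_mem)
  then have cn: "c < ncrs I" using capr_instanceD(3)[OF I a] by blast
  have rd: "arrs s Pref [a, p] = c" "arrs s CapC [c] = capC I c" "arrs s CapA [a] = capA I a"
    using input_storeD[OF representsD(1)[OF rep]] a p cn by auto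
  have "represents I \<sigma> r M (upd_var Crs c s)" using rep by (intro represents_upd_var) auto
  moreover have "input_store I \<sigma> ?s"
    by (rule input_store_same[OF representsD(1)[OF rep], of "{Crs}" "{Ptr}"])
      (auto simp: same_except_upd_arr same_except_upd_var same_except_refl)
  \<comment> \<open>The pointer advances before the outcome is known, so the shortened list
    \<open>cs\<close> is represented in every case.\<close>
  ultimately have rep1: "represents I \<sigma> (r(a := cs)) M ?s"
    using p unfolding represents_def by (simp add: store_simps)
  have mark1: "marked I {} ?s" using mark by (simp add: marked_def store_simps)
  have App1: "vars ?s App = a" "vars ?s Crs = c" using App by (simp_all add: store_simps)
  \<comment> \<open>A matching never exceeds a capacity, hence "less than" and "not full"
    agree.\<close>
  have test: "arrs s InBundle [a, c] = 0 \<and> arrs s Occ [c] < capC I c \<longleftrightarrow>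
      c \<notin> bundle_of M a \<and> \<not> full I M c"
    using M cn representsD(5,6)[OF rep a c] by (fastforce simp: matching_def full_def)
  show ?thesis
  proof (cases "c \<notin> bundle_of M a \<and> \<not> full I M c")
    case False
    then have "\<not> accepts I M a c" using self_in_gain[of c M a I] by (auto simp: accepts_def)
    then show ?thesis
      using False rep1 mark1 Done
      by (auto simp: wp_simps store_simps App p_def[symmetric] rd test keeps_control_def work_def)
  next
    case True
    define N where "N = (if accepts I M a c then M \<union> {a} \<times> ?G else M)"
    let ?add = "IF And (Eq (Var Ok) (Lit 1))
        (Less (Plus (Rd BundleLen [Var App]) (Var Size)) (Plus (Rd CapA [Var App]) (Lit 1)))
      THEN add_prog ELSE SKIP"
    let ?post = "\<lambda>b t s'. keeps_control s s' \<and> marked I {} s' \<and> represents I \<sigma> (r(a := cs)) N s' \<and>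
      vars s' Done = of_bool (accepts I M a c) \<and> t \<le> b"
    \<comment> \<open>What follows the search is analysed for an arbitrary store that the search may
      leave behind.\<close>
    have tail: "wp (?add;; unmark_prog) s2 (?post (100 + 80 * card ?G))"
      if same: "same_except {Size, Ok, Head, Cur, J, Nxt} {Queue, Mark} ?s s2"
        and bij: "bij_betw (queue s2) {..<vars s2 Size} ?G" and mark2: "marked I ?G s2"
        and Ok: "vars s2 Ok = of_bool (\<forall>d\<in>?G. \<not> full I M d)" for s2
    proof -
      have rep2: "represents I \<sigma> (r(a := cs)) M s2"
        using represents_same[OF rep1 same] by simp
      have App2: "vars s2 App = a" "vars s2 K = vars s K" "vars s2 Done = 0" "arrs s2 CapA [a] = capA I a"
        using same App Done rd(3) by (auto simp: same_except_def store_simps)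
      have Size: "vars s2 Size = card ?G" using bij_betw_same_card[OF bij] by simp
      have "arrs s2 BundleLen [a] = card (bundle_of M a)"
        using bij_betw_same_card[OF representsD(4)[OF rep2 a]] by simp
      then have acc: "vars s2 Ok = Suc 0 \<and> arrs s2 BundleLen [a] + vars s2 Size < Suc (capA I a) \<longleftrightarrow>
          accepts I M a c"
        using True Ok Size by (auto simp: accepts_def)
      \<comment> \<open>Unmarking ends both branches; \<open>N\<close> is the matching already
        represented when it starts.\<close>
      have clear: "wp unmark_prog s3 (?post (20 + 20 * card ?G))"
        if "represents I \<sigma> (r(a := cs)) N s3" "vars s3 Done = of_bool (accepts I M a c)"
          "vars s3 Size = card ?G" "arrs s3 Queue = arrs s2 Queue" "arrs s3 Mark = arrs s2 Mark"
          "vars s3 App = a" "vars s3 K = vars s K" for s3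
      proof -
        have "queue s3 ` {..<vars s3 Size} = ?G" "marked I ?G s3"
          using bij mark2 that Size by (simp_all add: bij_betw_def marked_def)
        from unmark_wp[OF this] show ?thesis
        proof (rule wp_mono, elim conjE, intro conjI)
          fix t s' assume un: "same_except {Head} {Mark} s3 s'" "marked I {} s'" and "t \<le> 20 + 20 * vars s3 Size"
          then show "t \<le> 20 + 20 * card ?G" "marked I {} s'" using that by simp_all
          show "represents I \<sigma> (r(a := cs)) N s'" using represents_same[OF that(1) un(1)] by simp
          show "keeps_control s s'" "vars s' Done = of_bool (accepts I M a c)"
            using un(1) that App by (simp_all add: same_except_def keeps_control_def)
        qed
      qed
      show ?thesis
      proof (cases "accepts I M a c")
        case False
        then have "wp unmark_prog s2 (?post (20 + 20 * card ?G))"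
          using rep2 App2 Size by (intro clear) (simp_all add: N_def)
        then show ?thesis
          using False by (simp add: wp_simps App2 acc) (erule wp_mono, simp)
      next
        case True
        have "finite M" using M finite_subset[of M "{..<napp I} \<times> {..<ncrs I}"]
          by (simp add: matching_def)
        then have "wp add_prog s2 (\<lambda>t s'. same_except {Head, Cur, Done} {Bundle, BundleLen, InBundle, Occ} s2 s' \<and>
            represents I \<sigma> (r(a := cs)) N s' \<and> vars s' Done = 1 \<and> t \<le> 30 + 60 * card ?G)"
          using add_wp[OF rep2 _ a App2(1) bij] True by (auto simp: N_def gain_def Size)
        then have "wp add_prog s2 (\<lambda>t s3. wp unmark_prog s3 (\<lambda>u. ?post (50 + 80 * card ?G) (t + u)))"
        proof (rule wp_mono, elim conjE)
          fix t s3 assume 3: "same_except {Head, Cur, Done} {Bundle, BundleLen, InBundle, Occ} s2 s3"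
            "represents I \<sigma> (r(a := cs)) N s3" "vars s3 Done = 1" and t: "t \<le> 30 + 60 * card ?G"
          then have "wp unmark_prog s3 (?post (20 + 20 * card ?G))"
            using App2 Size True by (intro clear) (simp_all add: same_except_def)
          then show "wp unmark_prog s3 (\<lambda>u. ?post (50 + 80 * card ?G) (t + u))"
            by (rule wp_mono) (use t in simp)
        qed
        then show ?thesis
          using True by (simp add: wp_simps App2 acc) (erule wp_mono, erule wp_mono, simp)
      qed
    qed
    define cost where "cost = (\<Sum>d\<in>?G. 60 + 60 * card (immediate I a d)) + 80 * card ?G"
    define q where "q = collect_prog;; ?add;; unmark_prog"
    \<comment> \<open>201 is 100 for the search, 100 for the tail and 1 for the sequencing between
      them.\<close>
    have "wp q ?s (?post (201 + cost))"
      unfolding q_def wp_Seq_assoc wp_simps(4)[of collect_prog]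
    proof (rule wp_mono[OF collect_wp[OF I a c M _ rep1 App1 mark1]], use True in simp, elim conjE)
      fix t s2
      assume "same_except {Size, Ok, Head, Cur, J, Nxt} {Queue, Mark} ?s s2"
        "bij_betw (queue s2) {..<vars s2 Size} ?G" "marked I ?G s2"
        "vars s2 Ok = of_bool (\<forall>d\<in>?G. \<not> full I M d)"
        and t: "t \<le> 100 + (\<Sum>d\<in>?G. 60 + 60 * card (immediate I a d))"
      from tail[OF this(1-4)] show "wp (?add;; unmark_prog) s2 (\<lambda>u. ?post (201 + cost) (1 + t + u))"
        by (rule wp_mono) (use t in \<open>simp add: cost_def\<close>)
    qed
    \<comment> \<open>The excess of 300 over 201 pays for reading the course, advancing the pointer
      and the first test.\<close>
    moreover have "300 + cost \<le> 500 * work I a"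
      using gain_cost[OF I a c, of M] by (simp add: cost_def work_def)
    ultimately show ?thesis
      using True unfolding q_def[symmetric] N_def[symmetric]
      by (simp add: wp_simps store_simps App p_def[symmetric] rd test split del: split_of_bool)
        (erule wp_mono, simp)
  qed
qed

text \<open>Each attempt is charged to the list entry that the pointer passes. Keeping the unread
  remainder on the left makes the bounds of successive turns telescope. The induction on the unread
  list follows the recursion of \<open>turn\<close>.\<close>

lemma turn_loop:
  assumes I: "capr_instance I" and a: "a < napp I" and M: "matching I M"
    and "represents I \<sigma> r M s" "vars s App = a" "marked I {} s" "vars s Done = 0" "r a = cs"
  shows "wp (WHILE And (Eq (Var Done) (Lit 0)) (Less (Rd Ptr [Var App]) (Rd PrefLen [Var App]))
      DO (attempt_prog)) s (\<lambda>t s'. keeps_control s s' \<and> marked I {} s' \<and>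
        represents I \<sigma> (r(a := fst (turn I a cs M))) (snd (turn I a cs M)) s' \<and>
        t + 600 * work I a * length (fst (turn I a cs M)) \<le> 20 + 600 * work I a * length cs)"
    (is "wp (WHILE ?b DO ?p) _ _")
  using assms(4-)
proof (induction cs arbitrary: r s)
  case Nil
  then have "arrs s Ptr [a] = length (pref I a)" "r(a := []) = r"
    using representsD(2,3)[OF Nil(1) a] by auto
  then show ?case
    using Nil input_storeD(6)[OF representsD(1)[OF Nil(1)] a]
    by (subst wp_While_unfold) (simp add: keeps_control_def)
next
  case (Cons c cs)
  have "drop (arrs s Ptr [a]) (pref I a) = c # cs"
    using representsD(3)[OF Cons.prems(1) a] Cons.prems(5) by simp
  then have "arrs s Ptr [a] < length (pref I a)"
    by (metis drop_eq_Nil leI list.distinct(1))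
  then have b: "bval s ?b"
    using Cons.prems input_storeD(6)[OF representsD(1)[OF Cons.prems(1)] a] by simp
  have w: "1 \<le> work I a" by (simp add: work_def)
  note attempt = attempt_wp[OF I a M Cons.prems]
  show ?case
    unfolding wp_While_unfold[of ?b ?p s] if_P[OF b]
  proof (rule wp_mono[OF attempt], elim conjE)
    fix t s1
    assume s1: "keeps_control s s1" "marked I {} s1"
      "represents I \<sigma> (r(a := cs)) (if accepts I M a c then M \<union> {a} \<times> gain I M a c else M) s1"
      "vars s1 Done = of_bool (accepts I M a c)" and t: "t \<le> 500 * work I a"
    show "wp (WHILE ?b DO ?p) s1 (\<lambda>u s'. keeps_control s s' \<and> marked I {} s' \<and>
        represents I \<sigma> (r(a := fst (turn I a (c # cs) M))) (snd (turn I a (c # cs) M)) s' \<and>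
        1 + bcost ?b + t + u + 600 * work I a * length (fst (turn I a (c # cs) M))
          \<le> 20 + 600 * work I a * length (c # cs))"
    proof (cases "accepts I M a c")
      case True
      \<comment> \<open>\<open>Done\<close> is set, so the loop ends at its next test.\<close>
      then show ?thesis
        using s1 t w by (subst wp_While_unfold) (simp add: turn_Cons)
    next
      case False
      have "vars s1 App = a" "represents I \<sigma> (r(a := cs)) M s1" "vars s1 Done = 0" "(r(a := cs)) a = cs"
        using s1 False Cons.prems(2) by (simp_all add: keeps_control_def)
      then have "wp (WHILE ?b DO ?p) s1 (\<lambda>t s'. keeps_control s1 s' \<and> marked I {} s' \<and>
        represents I \<sigma> ((r(a := cs))(a := fst (turn I a cs M))) (snd (turn I a cs M)) s' \<and>
        t + 600 * work I a * length (fst (turn I a cs M)) \<le> 20 + 600 * work I a * length cs)"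
        using s1(2) by (intro Cons.IH)
      then show ?thesis
        by (rule wp_mono) (use s1(1) t w False in \<open>auto simp: turn_Cons keeps_control_def\<close>)
    qed
  qed
qed

lemma turn_wp:
  assumes I: "capr_instance I" and a: "a < napp I" and M: "matching I M"
    and rep: "represents I \<sigma> r M s" and App: "vars s App = a" and mark: "marked I {} s"
    and st: "step I a (r, M) = (r', M')"
  shows "wp turn_prog s (\<lambda>t s'. keeps_control s s' \<and> marked I {} s' \<and> represents I \<sigma> r' M' s' \<and>
    t + 600 * work I a * length (r' a) \<le> 30 + 600 * work I a * length (r a))"
proof -
  let ?s = "upd_var Done 0 s"
  have "represents I \<sigma> r M ?s" using rep by (intro represents_upd_var) auto
  moreover have "marked I {} ?s" using mark by (simp add: marked_def store_simps)
  ultimately have "wp (WHILE And (Eq (Var Done) (Lit 0)) (Less (Rd Ptr [Var App]) (Rd PrefLen [Var App]))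
      DO (attempt_prog)) ?s (\<lambda>t s'. keeps_control ?s s' \<and> marked I {} s' \<and>
        represents I \<sigma> (r(a := fst (turn I a (r a) M))) (snd (turn I a (r a) M)) s' \<and>
        t + 600 * work I a * length (fst (turn I a (r a) M)) \<le> 20 + 600 * work I a * length (r a))"
    using App by (intro turn_loop[OF I a M]) (simp_all add: store_simps)
  moreover have "r' = r(a := fst (turn I a (r a) M))" "M' = snd (turn I a (r a) M)"
    using st by (auto simp: step_def split: prod.splits)
  ultimately show ?thesis
    unfolding turn_prog_def wp_simps(2,4)
    by simp (erule wp_mono, auto simp: keeps_control_def store_simps)
qed

section \<open>Initialisation and the main loop\<close>

definition cleared :: "nat \<Rightarrow> nat set \<Rightarrow> (var, arr) store \<Rightarrow> bool" where
  "cleared a X s \<longleftrightarrow> (\<forall>c\<in>X. arrs s Occ [c] = 0 \<and> arrs s Mark [c] = 0 \<and> arrs s InBundle [a, c] = 0)"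

text \<open>\<open>Occ\<close> and \<open>Mark\<close> cells are shared, so a course may be cleared
  once for each applicant who accepts it; since only zeros are written, claims about earlier
  applicants persist.\<close>

definition initialised :: "capr \<Rightarrow> nat \<Rightarrow> (var, arr) store \<Rightarrow> bool" where
  "initialised I n s \<longleftrightarrow> (\<forall>a<n. arrs s Ptr [a] = 0 \<and> arrs s BundleLen [a] = 0 \<and>
     cleared a (set (pref I a)) s)"

text \<open>Only acceptable courses are visited, so the time is linear in the number of applicants
  and the list lengths. Clearing a flag for every applicant and course would break the claimed bound
  when lists are empty.\<close>

lemma init_wp:
  assumes inp: "input_store I \<sigma> s0"
  shows "wp init_prog s0 (\<lambda>t s. represents I \<sigma> (pref I) {} s \<and> marked I {} s \<and>
    t \<le> 20 + (\<Sum>a<napp I. 50 + 50 * length (pref I a)))"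
proof -
  let ?R = "{Ptr, BundleLen, Occ, Mark, InBundle}"
  let ?same = "same_except {App, J, Crs} ?R s0"
  let ?Inv = "\<lambda>s. ?same s \<and> vars s App \<le> napp I \<and> initialised I (vars s App) s"
  let ?\<Phi> = "\<lambda>s. \<Sum>a\<in>{vars s App..<napp I}. 50 + 50 * length (pref I a)"
  let ?s = "upd_var App 0 s0"
  let ?inner = "WHILE Less (Var J) (Rd PrefLen [Var App]) DO (
         Crs ::= Rd Pref [Var App, Var J];;
         Occ \<langle>[Var Crs]\<rangle> ::= Lit 0;;
         Mark \<langle>[Var Crs]\<rangle> ::= Lit 0;;
         InBundle \<langle>[Var App, Var Crs]\<rangle> ::= Lit 0;;
         incr J
       )"
  have same_input: "input_store I \<sigma> s" if "?same s" for s
    by (rule input_store_same[OF inp that]) auto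
  have inner: "wp ?inner s (\<lambda>t s'. ?same s' \<and> vars s' App = a \<and> initialised I (Suc a) s' \<and>
      t \<le> 10 + 50 * length (pref I a))"
    if s: "?same s" "vars s App = a" "initialised I a s" "arrs s Ptr [a] = 0" "arrs s BundleLen [a] = 0"
      "vars s J = 0" and a: "a < napp I" for a s
  proof -
    let ?InvJ = "\<lambda>s. ?same s \<and> vars s App = a \<and> initialised I a s \<and> arrs s Ptr [a] = 0 \<and>
      arrs s BundleLen [a] = 0 \<and> vars s J \<le> length (pref I a) \<and>
      cleared a (set (take (vars s J) (pref I a))) s"
    let ?\<Psi> = "\<lambda>s. 50 * (length (pref I a) - vars s J)"
    have "wp ?inner s (\<lambda>t s'. ?InvJ s' \<and> \<not> bval s' (Less (Var J) (Rd PrefLen [Var App])) \<and>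
        t + ?\<Psi> s' \<le> 1 + bcost (Less (Var J) (Rd PrefLen [Var App]) :: (var, arr) bexp) + ?\<Psi> s)"
      (is "wp (WHILE ?b DO ?p) _ _")
    proof (rule wp_While)
      show "?InvJ s" using s by (simp add: cleared_def)
    next
      fix s1 assume inv: "?InvJ s1" and b: "bval s1 ?b"
      note in1 = same_input[of s1]
      have J: "vars s1 J < length (pref I a)" using b inv input_storeD(6)[OF in1 a] by simp
      let ?c = "pref I a ! vars s1 J"
      have rd: "arrs s1 Pref [a, vars s1 J] = ?c" using inv input_storeD(7)[OF in1 a J] by simp
      have tk: "set (take (Suc (vars s1 J)) (pref I a)) = insert ?c (set (take (vars s1 J) (pref I a)))"
        using J by (simp add: take_Suc_conv_app_nth)
      show "wp ?p s1 (\<lambda>t s'. ?InvJ s' \<and> 1 + bcost ?b + t + ?\<Psi> s' \<le> ?\<Psi> s1)"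
        using inv J
        by (simp add: wp_simps store_simps rd tk same_except_upd_var same_except_upd_arr)
          (simp add: cleared_def initialised_def store_simps)
    qed
    then show ?thesis
    proof (rule wp_mono, elim conjE, intro conjI)
      fix t s' assume 1: "?same s'" "vars s' App = a" "initialised I a s'" "arrs s' Ptr [a] = 0"
        "arrs s' BundleLen [a] = 0" "vars s' J \<le> length (pref I a)"
        "cleared a (set (take (vars s' J) (pref I a))) s'" "\<not> bval s' ?b"
        and t: "t + ?\<Psi> s' \<le> 1 + bcost ?b + ?\<Psi> s"
      then have "vars s' J = length (pref I a)" using input_storeD(6)[OF same_input[OF 1(1)] a] by simp
      then show "initialised I (Suc a) s'" using 1 by (simp add: initialised_def less_Suc_eq)
      show "t \<le> 10 + 50 * length (pref I a)" using t s(6) by simp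
    qed
  qed
  have "wp (WHILE Less (Var App) (Var NApp) DO (
       Ptr \<langle>[Var App]\<rangle> ::= Lit 0;;
       BundleLen \<langle>[Var App]\<rangle> ::= Lit 0;;
       J ::= Lit 0;;
       ?inner;;
       incr App)) ?s (\<lambda>t s'. ?Inv s' \<and> \<not> bval s' (Less (Var App) (Var NApp)) \<and>
        t + ?\<Phi> s' \<le> 1 + bcost (Less (Var App) (Var NApp) :: (var, arr) bexp) + ?\<Phi> ?s)"
    (is "wp (WHILE ?b DO ?p) _ _")
  proof (rule wp_While)
    show "?Inv ?s" by (simp add: same_except_upd_var same_except_refl store_simps initialised_def)
  next
    fix s1 assume inv: "?Inv s1" and b: "bval s1 ?b"
    let ?a = "vars s1 App"
    have a: "?a < napp I" using b inv input_storeD(1)[OF same_input[of s1]] by simp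
    let ?s1 = "upd_var J 0 (upd_arr BundleLen [?a] 0 (upd_arr Ptr [?a] 0 s1))"
    have "initialised I ?a ?s1" using inv by (simp add: initialised_def cleared_def store_simps)
    then have "wp ?inner ?s1 (\<lambda>t s'. ?same s' \<and> vars s' App = ?a \<and> initialised I (Suc ?a) s' \<and>
      t \<le> 10 + 50 * length (pref I ?a))"
      using inv a by (intro inner) (simp_all add: store_simps same_except_upd_var same_except_upd_arr)
    moreover have "?\<Phi> s1 = 50 + 50 * length (pref I ?a) + (\<Sum>a\<in>{Suc ?a..<napp I}. 50 + 50 * length (pref I a))"
      using a by (simp add: sum.atLeast_Suc_lessThan)
    ultimately show "wp ?p s1 (\<lambda>t s'. ?Inv s' \<and> 1 + bcost ?b + t + ?\<Phi> s' \<le> ?\<Phi> s1)"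
      using a by (simp add: wp_simps store_simps)
        (erule wp_mono, auto simp: store_simps same_except_upd_var initialised_def cleared_def)
  qed
  then have "wp (WHILE ?b DO ?p) ?s (\<lambda>t s. represents I \<sigma> (pref I) {} s \<and> marked I {} s \<and>
    t \<le> 10 + (\<Sum>a<napp I. 50 + 50 * length (pref I a)))"
  proof (rule wp_mono, elim conjE, intro conjI)
    fix t s assume 1: "?same s" "vars s App \<le> napp I" "initialised I (vars s App) s" "\<not> bval s ?b"
      and t: "t + ?\<Phi> s \<le> 1 + bcost ?b + ?\<Phi> ?s"
    then have "vars s App = napp I" using input_storeD(1)[OF same_input[OF 1(1)]] by simp
    then show "represents I \<sigma> (pref I) {} s" "marked I {} s"
      using 1(3) same_input[OF 1(1)] by (simp_all add: represents_def marked_def initialised_def cleared_def bij_betw_def)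
    show "t \<le> 10 + (\<Sum>a<napp I. 50 + 50 * length (pref I a))"
      using t by (simp add: store_simps atLeast0LessThan)
  qed
  then show ?thesis
    unfolding init_prog_def wp_simps(2,4) by simp (erule wp_mono, simp)
qed

text \<open>The invariant ties \<open>K\<close> to the abstract state after the first
  \<open>K\<close> policy entries. The turns share one potential, so reading lists is paid for once
  in the whole run rather than once per turn.\<close>

lemma main_loop:
  assumes I: "capr_instance I" and \<sigma>: "set \<sigma> \<subseteq> {..<napp I}"
    and rep: "represents I \<sigma> (pref I) {} s" and mark: "marked I {} s" and K: "vars s K = 0"
  shows "wp (WHILE Less (Var K) (Var PolLen) DO (
       App ::= Rd Pol [Var K];;
       turn_prog;;
       incr K
     )) s (\<lambda>t s'. (\<exists>r. represents I \<sigma> r (sm_capr I \<sigma>) s') \<and>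
       t \<le> 10 + 60 * length \<sigma> + (\<Sum>a<napp I. 600 * work I a * length (pref I a)))"
    (is "wp (WHILE ?b DO ?p) _ _")
proof -
  let ?st = "\<lambda>k. fold (step I) (take k \<sigma>) (pref I, {})"
  let ?F = "\<lambda>r :: nat \<Rightarrow> nat list. \<Sum>a<napp I. 600 * work I a * length (r a)"
  let ?Inv = "\<lambda>s. vars s K \<le> length \<sigma> \<and> marked I {} s \<and>
    represents I \<sigma> (fst (?st (vars s K))) (snd (?st (vars s K))) s"
  \<comment> \<open>60 per remaining turn for its constant cost, plus the charge for all unread list
    entries.\<close>
  let ?\<Phi> = "\<lambda>s. 60 * (length \<sigma> - vars s K) + ?F (fst (?st (vars s K)))"
  have "wp (WHILE ?b DO ?p) s (\<lambda>t s'. ?Inv s' \<and> \<not> bval s' ?b \<and> t + ?\<Phi> s' \<le> 1 + bcost ?b + ?\<Phi> s)"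
  proof (rule wp_While)
    show "?Inv s" using rep mark K by simp
  next
    fix s1 assume inv: "?Inv s1" and b: "bval s1 ?b"
    let ?k = "vars s1 K"
    obtain r M where st: "?st ?k = (r, M)" by fastforce
    have rep1: "represents I \<sigma> r M s1" using inv st by simp
    have k: "?k < length \<sigma>" using b input_storeD(2)[OF representsD(1)[OF rep1]] by simp
    define a where "a = \<sigma> ! ?k"
    have a: "a < napp I" using subsetD[OF \<sigma> nth_mem[OF k]] by (simp add: a_def)
    have pol: "arrs s1 Pol [?k] = a" using input_storeD(3)[OF representsD(1)[OF rep1] k] by (simp add: a_def)
    obtain r' M' where step: "step I a (r, M) = (r', M')" by fastforce
    then have st': "?st (Suc ?k) = (r', M')"
      using st k by (simp add: take_Suc_conv_app_nth a_def)
    have "set (take ?k \<sigma>) \<subseteq> {..<napp I}" using \<sigma> set_take_subset by fast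
    from valid_state_fold[OF I this valid_state_init] have M: "matching I M"
      by (simp add: st valid_state_def)
    let ?s1 = "upd_var App a s1"
    have "represents I \<sigma> r M ?s1" using rep1 by (intro represents_upd_var) auto
    moreover have "marked I {} ?s1" "vars ?s1 App = a" using inv by (simp_all add: marked_def store_simps)
    ultimately have turn: "wp turn_prog ?s1 (\<lambda>t s'. keeps_control ?s1 s' \<and> marked I {} s' \<and> represents I \<sigma> r' M' s' \<and>
        t + 600 * work I a * length (r' a) \<le> 30 + 600 * work I a * length (r a))"
      using turn_wp[OF I a M _ _ _ step] by blast
    have "r' b = r b" if "b \<noteq> a" for b
      using step that by (auto simp: step_def split: prod.splits)
    \<comment> \<open>Only the list of \<open>a\<close> changes. The equation is written with sums
      on both sides to avoid truncated subtraction.\<close>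
    then have F: "?F r' + 600 * work I a * length (r a) = ?F r + 600 * work I a * length (r' a)"
      using a by (simp add: sum.remove[of "{..<napp I}" a])
    have left: "60 * (length \<sigma> - ?k) = 60 + 60 * (length \<sigma> - Suc ?k)" using k by simp
    have "wp turn_prog ?s1 (\<lambda>t s'. vars s' K = ?k \<and> marked I {} s' \<and>
        represents I \<sigma> r' M' (upd_var K (Suc ?k) s') \<and> t + ?F r' \<le> 30 + ?F r)"
      by (rule wp_mono[OF turn]) (use F in \<open>auto simp: keeps_control_def store_simps intro!: represents_upd_var\<close>)
    then show "wp ?p s1 (\<lambda>t s'. ?Inv s' \<and> 1 + bcost ?b + t + ?\<Phi> s' \<le> ?\<Phi> s1)"
      using k by (simp add: wp_simps pol)
        (erule wp_mono, simp add: store_simps st st' marked_def left)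
  qed
  then show ?thesis
  proof (rule wp_mono, elim conjE, intro conjI)
    fix t s' assume 1: "vars s' K \<le> length \<sigma>" "\<not> bval s' ?b"
      "represents I \<sigma> (fst (?st (vars s' K))) (snd (?st (vars s' K))) s'"
      and t: "t + ?\<Phi> s' \<le> 1 + bcost ?b + ?\<Phi> s"
    then have "vars s' K = length \<sigma>" using input_storeD(2)[OF representsD(1)[OF 1(3)]] by simp
    then have "represents I \<sigma> (fst (?st (vars s' K))) (sm_capr I \<sigma>) s'"
      using 1(3) by (simp add: sm_capr_def run_eq_fold)
    then show "\<exists>r. represents I \<sigma> r (sm_capr I \<sigma>) s'" by blast
    show "t \<le> 10 + 60 * length \<sigma> + ?F (pref I)" using t K by simp
  qed
qed

section \<open>Output and total running time\<close>

lemma output_represents: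
  assumes "represents I \<sigma> r M s" "M \<subseteq> {..<napp I} \<times> UNIV"
  shows "output_matching I s = M"
proof -
  have "(\<lambda>k. arrs s Bundle [a, k]) ` {..<arrs s BundleLen [a]} = bundle_of M a" if "a < napp I" for a
    using representsD(4)[OF assms(1) that] by (simp add: bij_betw_def)
  then have "(a, c) \<in> output_matching I s \<longleftrightarrow> a < napp I \<and> c \<in> bundle_of M a" for a c
    unfolding output_matching_def by (auto simp: image_iff set_eq_iff)
  then show ?thesis using assms(2) by (auto simp: set_eq_iff)
qed

lemma policy_length:
  assumes "policy I \<sigma>"
  shows "length \<sigma> \<le> total_capacity I"
proof -
  have "length \<sigma> = (\<Sum>a<napp I. count_list \<sigma> a)"
    using assms sum_count_set[of \<sigma> "{..<napp I}"] by (simp add: policy_def)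
  also have "\<dots> \<le> total_capacity I"
    unfolding total_capacity_def using assms by (intro sum_mono) (simp add: policy_def)
  finally show ?thesis .
qed

text \<open>Initialisation visits every applicant, even one with an empty list; positive capacities
  allow this to be charged to the total capacity.\<close>

lemma napp_le_total_capacity:
  assumes "capr_instance I"
  shows "napp I \<le> total_capacity I"
proof -
  have "(\<Sum>a<napp I. 1) \<le> total_capacity I"
    unfolding total_capacity_def using capr_instanceD(1)[OF assms]
    by (intro sum_mono) (simp add: Suc_le_eq)
  then show ?thesis by simp
qed

lemma length_pref_le:
  assumes "capr_instance I" "a < napp I"
  shows "length (pref I a) \<le> ncrs I"
  using card_mono[OF _ capr_instanceD(3)[OF assms]] distinct_card[OF capr_instanceD(2)[OF assms]] by simp

lemma search_cost:
  assumes I: "capr_instance I"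
  shows "(\<Sum>a<napp I. work I a * length (pref I a)) \<le>
    ncrs I * (2 * total_pref_length I + total_immediate I)"
proof -
  have "work I a * length (pref I a) \<le>
      ncrs I * (2 * length (pref I a) + (\<Sum>c<ncrs I. card (immediate I a c)))" if a: "a < napp I" for a
  proof -
    let ?l = "length (pref I a)" and ?d = "\<Sum>c<ncrs I. card (immediate I a c)"
    have l: "?l \<le> ncrs I" by (rule length_pref_le[OF I a])
    \<comment> \<open>A nonempty list requires a course. This absorbs the constant part of
      \<open>work\<close> and is the source of the factor 2.\<close>
    then have "?l \<le> ncrs I * ?l" by (cases "ncrs I") auto
    \<comment> \<open>Here the number of attempts is bounded by \<open>ncrs I\<close>, so that the
      number of immediate prerequisites is not multiplied by a list length.\<close>
    moreover have "?d * ?l \<le> ncrs I * ?d" using l by (simp add: mult.commute)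
    moreover have "work I a * ?l = ?l + ncrs I * ?l + ?d * ?l" by (simp add: work_def distrib_right)
    ultimately have "work I a * ?l \<le> ncrs I * ?l + ncrs I * ?l + ncrs I * ?d" by linarith
    then show ?thesis by (simp add: algebra_simps)
  qed
  then have "(\<Sum>a<napp I. work I a * length (pref I a)) \<le>
      (\<Sum>a<napp I. ncrs I * (2 * length (pref I a) + (\<Sum>c<ncrs I. card (immediate I a c))))"
    by (intro sum_mono) simp
  then show ?thesis
    by (simp add: total_pref_length_def total_immediate_def sum.distrib sum_distrib_left distrib_left)
qed

text \<open>Lets the size measure absorb the linear cost of initialisation: without courses all
  lists are empty, otherwise the factor is at least one.\<close>

lemma total_pref_length_le:
  assumes I: "capr_instance I"
  shows "total_pref_length I \<le> ncrs I * total_pref_length I"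
proof (cases "ncrs I = 0")
  case True
  then show ?thesis using length_pref_le[OF I] by (simp add: total_pref_length_def)
qed simp

lemma sm_capr_prog_wp:
  assumes I: "capr_instance I" and pol: "policy I \<sigma>" and inp: "input_store I \<sigma> s"
  shows "wp sm_capr_prog s (\<lambda>t s'. output_matching I s' = sm_capr I \<sigma> \<and>
    t \<le> 3000 * max 1 (total_capacity I + ncrs I * (total_pref_length I + total_immediate I)))"
proof -
  have \<sigma>: "set \<sigma> \<subseteq> {..<napp I}" using pol by (simp add: policy_def)
  have "valid_state I (fold (step I) \<sigma> (pref I, {}))"
    by (rule valid_state_fold[OF I \<sigma> valid_state_init])
  then have "matching I (sm_capr I \<sigma>)"
    by (auto simp: sm_capr_def run_eq_fold valid_state_def split: prod.splits)
  then have out: "output_matching I s' = sm_capr I \<sigma>" if "represents I \<sigma> r (sm_capr I \<sigma>) s'" for r s'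
    using output_represents[OF that] by (auto simp: matching_def)
  define P where "P = ncrs I * (total_pref_length I + total_immediate I)"
  let ?W = "\<Sum>a<napp I. 600 * work I a * length (pref I a)"
  have "?W = 600 * (\<Sum>a<napp I. work I a * length (pref I a))"
    by (simp add: sum_distrib_left mult.assoc)
  then have "?W \<le> 1200 * P"
    using search_cost[OF I] by (simp add: P_def algebra_simps)
  moreover have "(\<Sum>a<napp I. 50 + 50 * length (pref I a)) = 50 * napp I + 50 * total_pref_length I"
    by (simp add: total_pref_length_def sum.distrib sum_distrib_left)
  moreover have "total_pref_length I \<le> P"
    by (rule order_trans[OF total_pref_length_le[OF I]]) (simp add: P_def distrib_left)
  moreover define m where "m = max 1 (total_capacity I + P)"
  moreover have "1 \<le> m" "total_capacity I + P \<le> m" by (simp_all add: m_def)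
  \<comment> \<open>The sum is at most \<open>100 + 110 * total_capacity I + 1250 * P\<close>, well
    below \<open>3000 * m\<close>; the maximum with 1 absorbs the additive constant.\<close>
  ultimately have bound: "100 + (\<Sum>a<napp I. 50 + 50 * length (pref I a)) + 60 * length \<sigma> + ?W \<le>
      3000 * m"
    using policy_length[OF pol] napp_le_total_capacity[OF I] by linarith
  show ?thesis
    unfolding sm_capr_prog_def wp_simps(2,4) P_def[symmetric] m_def[symmetric]
  proof (rule wp_mono[OF init_wp[OF inp]], elim conjE)
    fix t s1 assume rep: "represents I \<sigma> (pref I) {} s1" and mark: "marked I {} s1"
      and t: "t \<le> 20 + (\<Sum>a<napp I. 50 + 50 * length (pref I a))"
    let ?s1 = "upd_var K (val s1 (Lit 0)) s1"
    have "represents I \<sigma> (pref I) {} ?s1" using rep by (intro represents_upd_var) auto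
    moreover have "marked I {} ?s1" "vars ?s1 K = 0" using mark by (simp_all add: marked_def store_simps)
    ultimately show "wp (WHILE Less (Var K) (Var PolLen) DO (
        App ::= Rd Pol [Var K];;
        turn_prog;;
        incr K
      )) ?s1 (\<lambda>u s'. output_matching I s' = sm_capr I \<sigma> \<and>
        1 + (1 + t + (1 + cost (Lit 0 :: (var, arr) exp))) + u \<le> 3000 * m)"
      by (intro wp_mono[OF main_loop[OF I \<sigma>]]) (use out t bound in auto)
  qed
qed

theorem theorem3:
  shows "\<exists>B::nat. \<forall>I \<sigma>. capr_instance I \<longrightarrow> policy I \<sigma> \<longrightarrow>
    matching I (sm_capr I \<sigma>) \<and>
    ((\<forall>a<napp I. count_list \<sigma> a = capA I a \<or> sm_capr I (\<sigma> @ [a]) = sm_capr I \<sigma>) \<longrightarrow>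
      pareto_optimal I (sm_capr I \<sigma>)) \<and>
    (\<forall>s. input_store I \<sigma> s \<longrightarrow>
      (\<exists>t s'. (sm_capr_prog, s) \<Rightarrow>[t] s' \<and> output_matching I s' = sm_capr I \<sigma> \<and>
        t \<le> B * max 1 (total_capacity I +
          ncrs I * (total_pref_length I + total_immediate I))))"
proof (rule exI[of _ 3000], intro allI impI conjI)
  fix I \<sigma> assume I: "capr_instance I" and pol: "policy I \<sigma>"
  have \<sigma>: "set \<sigma> \<subseteq> {..<napp I}" using pol by (simp add: policy_def)
  obtain r M where st: "fold (step I) \<sigma> (pref I, {}) = (r, M)" by fastforce
  then have M: "sm_capr I \<sigma> = M" by (simp add: sm_capr_def run_eq_fold)
  show "matching I (sm_capr I \<sigma>)"
    using valid_state_fold[OF I \<sigma> valid_state_init] unfolding M st by (simp add: valid_state_def)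
  show "pareto_optimal I (sm_capr I \<sigma>)"
    if "\<forall>a<napp I. count_list \<sigma> a = capA I a \<or> sm_capr I (\<sigma> @ [a]) = sm_capr I \<sigma>"
    unfolding M
  proof (rule pareto_optimal_run[OF I \<sigma> st])
    fix a assume "a < napp I"
    \<comment> \<open>An appended policy entry amounts to one more \<open>step\<close> from the
      final state, which turns the condition of the theorem into that of
      \<open>pareto_optimal_run\<close>.\<close>
    moreover have "sm_capr I (\<sigma> @ [a]) = snd (step I a (r, M))"
      using st by (simp add: sm_capr_def run_eq_fold)
    ultimately show "count_list \<sigma> a = capA I a \<or> snd (step I a (r, M)) = M"
      using that M by metis
  qed
  show "\<exists>t s'. (sm_capr_prog, s) \<Rightarrow>[t] s' \<and> output_matching I s' = sm_capr I \<sigma> \<and>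
      t \<le> 3000 * max 1 (total_capacity I + ncrs I * (total_pref_length I + total_immediate I))"
    if "input_store I \<sigma> s" for s
    using sm_capr_prog_wp[OF I pol that] by (simp add: wp_def)
qed

end
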